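(* Let $\mathcal{G}$ be a weakly logarithmic class of assemblies with parameters $\rho,\Theta,\theta,\theta'>0$ and $n_0\ge 1$. There is a constant $C>0$, depending only on $\rho,\Theta,\theta,\theta',n_0$, such that for every $n\ge 1$ and every additive function $h:\mathcal{G}_n\to\mathbb{R}$ defined by a real array $\{h_j(k)\}$ (as in the context), $$\mathbf{V}_n h\le C\sum_{\substack{j,k\in\mathbb{N}\\ jk\le n}}\frac{\lambda_j^k\,h_j(k)^2}{k!}\,\frac{Q^{\{j\}}(n-jk)}{Q(n)}.$$
   Context: An assembly on a finite set is a partition of the set into blocks (components) together with a choice of one of finitely many structures on each block; for a block of size $j$ there are $g_j<\infty$ possible structures (the $g_j\ge 0$ are fixed integers characterizing the class $\mathcal{G}$). $\mathcal{G}_n$ is the set of assemblies on an $n$-element set. Put $\lambda_j=g_j/j!$. For $\bar s=(s_1,\dots,s_n)\in\mathbb{N}_0^n$ let $\ell(\bar s)=1s_1+2s_2+\cdots+ns_n$. Define $$Q(n)=\sum_{\ell(\bar s)=n}\prod_{i=1}^n\frac{\lambda_i^{s_i}}{s_i!},\qquad Q^{\{j\}}(n)=\sum_{\substack{\ell(\bar s)=n\\ s_j=0}}\prod_{i=1}^n\frac{\lambda_i^{s_i}}{s_i!}\ (j\in\mathbb{N}),$$ with $Q(0)=Q^{\{j\}}(0)=1$. The number of assemblies in $\mathcal{G}_n$ is $G(n)=n!\,Q(n)$. The class $\mathcal{G}$ is weakly logarithmic if there are constants $\rho,\Theta,\theta,\theta'>0$ and $n_0\ge1$ such that: (i) $\rho^j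 j\lambda_j\le\Theta$ for all $j\ge1$; (ii) $\sum_{j\le n}\rho^j j\lambda_j\ge\theta n$ for all $n\ge n_0$; (iii) $nQ(n)\rho^n\ge\theta'\exp\{\sum_{j\le n}\lambda_j\rho^j\}$ for all $n\ge1$. For $\sigma\in\mathcal{G}_n$ and $1\le j\le n$, $k_j(\sigma)\ge0$ denotes the number of components of size $j$ in $\sigma$. An additive function $h:\mathcal{G}_n\to\mathbb{R}$ is given by a real array $\{h_j(k)\}$, $j,k\in\mathbb{N}_0$, $jk\le n$, with $h_j(0)=0$ for all $j\le n$, via $h(\sigma)=\sum_{j=1}^n h_j(k_j(\sigma))$. $\mathbf{E}_n$ and $\mathbf{V}_n$ denote expectation and variance with respect to the uniform probability measure on $\mathcal{G}_n$: $\mathbf{V}_n h=\frac{1}{G(n)}\sum_{\sigma\in\mathcal{G}_n}(h(\sigma)-\mathbf{E}_n h)^2$. *)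

theory Defs
  imports Complex_Main "HOL-Library.Disjoint_Sets"
begin

definition lam :: "(nat \<Rightarrow> nat) \<Rightarrow> nat \<Rightarrow> real" where
  "lam g j = real (g j) / fact j"

definition vecs :: "nat \<Rightarrow> (nat \<Rightarrow> nat) set" where
  "vecs n = {s. (\<forall>i. i \<notin> {1..n} \<longrightarrow> s i = 0) \<and> (\<forall>i. s i \<le> n) \<and> (\<Sum>i=1..n. i * s i) = n}"

definition weight :: "(nat \<Rightarrow> nat) \<Rightarrow> nat \<Rightarrow> (nat \<Rightarrow> nat) \<Rightarrow> real" where
  "weight g n s = (\<Prod>i=1..n. lam g i ^ s i / fact (s i))"

definition Qf :: "(nat \<Rightarrow> nat) \<Rightarrow> nat \<Rightarrow> real" where
  "Qf g n = (\<Sum>s\<in>vecs n. weight g n s)"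

definition Qexcl :: "(nat \<Rightarrow> nat) \<Rightarrow> nat \<Rightarrow> nat \<Rightarrow> real" where
  "Qexcl g j n = (\<Sum>s\<in>{s\<in>vecs n. s j = 0}. weight g n s)"

text \<open>Assemblies on {0..<n}: a set partition P of {0..<n} together with a structure
  f B \<in> {0..<g (card B)} on each block B (f is extensional: 0 off P).\<close>
definition assemblies :: "(nat \<Rightarrow> nat) \<Rightarrow> nat \<Rightarrow> (nat set set \<times> (nat set \<Rightarrow> nat)) set" where
  "assemblies g n = {(P, f). partition_on {0..<n} P \<and> (\<forall>B\<in>P. f B < g (card B))
                              \<and> (\<forall>B. B \<notin> P \<longrightarrow> f B = 0)}"

definition kcnt :: "nat \<Rightarrow> nat set set \<times> (nat set \<Rightarrow> nat) \<Rightarrow> nat" where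
  "kcnt j \<sigma> = card {B \<in> fst \<sigma>. card B = j}"

definition additive :: "nat \<Rightarrow> (nat \<Rightarrow> nat \<Rightarrow> real) \<Rightarrow> nat set set \<times> (nat set \<Rightarrow> nat) \<Rightarrow> real" where
  "additive n h \<sigma> = (\<Sum>j=1..n. h j (kcnt j \<sigma>))"

definition En :: "(nat \<Rightarrow> nat) \<Rightarrow> nat \<Rightarrow> (nat set set \<times> (nat set \<Rightarrow> nat) \<Rightarrow> real) \<Rightarrow> real" where
  "En g n F = (\<Sum>\<sigma>\<in>assemblies g n. F \<sigma>) / real (card (assemblies g n))"

definition Vn :: "(nat \<Rightarrow> nat) \<Rightarrow> nat \<Rightarrow> (nat set set \<times> (nat set \<Rightarrow> nat) \<Rightarrow> real) \<Rightarrow> real" where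
  "Vn g n F = (\<Sum>\<sigma>\<in>assemblies g n. (F \<sigma> - En g n F)^2) / real (card (assemblies g n))"

definition weakly_log :: "(nat \<Rightarrow> nat) \<Rightarrow> real \<Rightarrow> real \<Rightarrow> real \<Rightarrow> real \<Rightarrow> nat \<Rightarrow> bool" where
  "weakly_log g \<rho> \<Theta> \<theta> \<theta>' n0 \<longleftrightarrow>
     \<rho> > 0 \<and> \<Theta> > 0 \<and> \<theta> > 0 \<and> \<theta>' > 0 \<and> n0 \<ge> 1 \<and>
     (\<forall>j\<ge>1. \<rho>^j * real j * lam g j \<le> \<Theta>) \<and>
     (\<forall>n\<ge>n0. (\<Sum>j=1..n. \<rho>^j * real j * lam g j) \<ge> \<theta> * real n) \<and>
     (\<forall>n\<ge>1. real n * Qf g n * \<rho>^n \<ge> \<theta>' * exp (\<Sum>j=1..n. lam g j * \<rho>^j))"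

end

theory Submission
  imports Defs "HOL-Analysis.Convex"
begin

text \<open>
  Put \<open>a\<^sub>j = \<lambda>\<^sub>j \<rho>\<^sup>j\<close> and \<open>q(n) = Q(n) \<rho>\<^sup>n\<close>. The component counts of a random assembly are independent
  (truncated) Poisson variables with parameters \<open>a\<^sub>j\<close>, conditioned on \<open>\<ell>(s) = n\<close>, and the right-hand
  side of the theorem is \<open>\<Sum>\<^sub>j E\<^sub>n h\<^sub>j(k\<^sub>j)\<^sup>2\<close>. The terms with \<open>j\<close> below a constant and those with
  \<open>j k\<^sub>j > n/3\<close> are boundedly many in every assembly and are handled by Cauchy-Schwarz. For the
  rest, let \<open>F\<close> be their sum, centred at its mean under the independent model. Writing
  \<open>n = \<Sum>\<^sub>j j k\<^sub>j\<close> and removing one component of size \<open>j\<close> (size biasing) bounds \<open>n q(n) E\<^sub>n F\<^sup>2\<close> by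
  sums over all vectors with \<open>\<ell>(s) < n\<close>, i.e. by an unconditional Poisson expectation, where
  independence gives the variance. Finally \<open>n q(n) \<ge> \<theta>' exp (\<Sum>\<^sub>j\<^sub>\<le>\<^sub>n a\<^sub>j)\<close>, and for the remaining
  \<open>(j, k)\<close> the Poisson probabilities are at most a constant times the conditioned ones, because
  \<open>q\<^sup>(\<^sup>j\<^sup>)(m) \<ge> q(m) - a\<^sub>j q(m - j) \<ge> q(m)/2\<close> when \<open>j\<close> is large and \<open>m\<close> is comparable to \<open>n\<close>.
\<close>

section \<open>Weighted sums over component vectors\<close>

lemma nat_mult_le_imp_le:
  fixes j k n :: nat
  assumes "1 \<le> j" "j * k \<le> n"
  shows "k \<le> n"
  using mult_le_mono1[OF assms(1), of k] assms(2) by linarith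

text \<open>The parameter sequence is arbitrary because the weights are needed both for
  \<open>lam g\<close> and for its rescaling by powers of \<rho>. Up to the factor exp of minus the
  sum of the \<open>a i\<close>, this is the joint probability of independent Poisson
  counts.\<close>

definition pwt :: "(nat \<Rightarrow> real) \<Rightarrow> nat \<Rightarrow> (nat \<Rightarrow> nat) \<Rightarrow> real" where
  "pwt a n s = (\<Prod>i=1..n. a i ^ s i / fact (s i))"

text \<open>The sample space of the independent model. Truncating every count at \<open>n\<close>
  keeps it finite while it still contains \<open>vecs m\<close> for all m \<le> n.\<close>

definition count_box :: "nat \<Rightarrow> (nat \<Rightarrow> nat) set" where
  "count_box n = {s. (\<forall>i. i \<notin> {1..n} \<longrightarrow> s i = 0) \<and> (\<forall>i. s i \<le> n)}"

lemma weight_eq_pwt: "weight g n s = pwt (lam g) n s"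
  by (simp add: weight_def pwt_def)

lemma pwt_nonneg: "(\<And>i. a i \<ge> 0) \<Longrightarrow> pwt a n s \<ge> 0"
  unfolding pwt_def by (intro prod_nonneg) auto

lemma sum_box_prod:
  fixes f :: "nat \<Rightarrow> nat \<Rightarrow> real"
  shows "(\<Sum>s\<in>count_box n. \<Prod>i=1..n. f i (s i)) = (\<Prod>i=1..n. \<Sum>k\<le>n. f i k)"
proof -
  have "(\<Prod>i=1..n. \<Sum>k\<le>n. f i k) = (\<Sum>s\<in>PiE {1..n} (\<lambda>_. {..n}). \<Prod>i=1..n. f i (s i))"
    by (rule prod_sum_PiE) auto
  also have "\<dots> = (\<Sum>s\<in>count_box n. \<Prod>i=1..n. f i (s i))"
    by (rule sum.reindex_bij_witness[where j = "\<lambda>s i. if i \<in> {1..n} then s i else 0"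
          and i = "\<lambda>s. restrict s {1..n}"])
      (auto simp: count_box_def PiE_def extensional_def Pi_def fun_eq_iff restrict_def intro!: prod.cong)
  finally show ?thesis ..
qed

lemma finite_box: "finite (count_box n)"
proof -
  have "count_box n \<subseteq> (\<lambda>s i. if i \<in> {1..n} then s i else 0) ` PiE {1..n} (\<lambda>_. {..n})"
  proof
    fix s assume s: "s \<in> count_box n"
    then have "s = (\<lambda>i. if i \<in> {1..n} then restrict s {1..n} i else 0)"
      by (auto simp: count_box_def fun_eq_iff)
    moreover have "restrict s {1..n} \<in> PiE {1..n} (\<lambda>_. {..n})"
      using s by (auto simp: count_box_def)
    ultimately show "s \<in> (\<lambda>s i. if i \<in> {1..n} then s i else 0) ` PiE {1..n} (\<lambda>_. {..n})"
      by blast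
  qed
  then show ?thesis by (rule finite_subset) (auto intro: finite_PiE)
qed

text \<open>Vectors of different lengths are put on one common index range \<open>{1..n}\<close>.
  The support and size bounds in \<open>vecs m\<close> follow from the length equation, since each
  single term \<open>i * s i\<close> is at most \<open>m\<close>.\<close>

lemma vecs_iff:
  assumes "m \<le> n"
  shows "s \<in> vecs m \<longleftrightarrow> (\<forall>i. i \<notin> {1..n} \<longrightarrow> s i = 0) \<and> (\<Sum>i=1..n. i * s i) = m"
    (is "_ \<longleftrightarrow> ?S \<and> ?L = m")
proof
  assume s: "s \<in> vecs m"
  have "(\<Sum>i=1..m. i * s i) = ?L"
    by (rule sum.mono_neutral_left) (use s assms in \<open>auto simp: vecs_def\<close>)
  then show "?S \<and> ?L = m" using s assms by (auto simp: vecs_def)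
next
  assume s: "?S \<and> ?L = m"
  have le: "i * s i \<le> m" if "i \<in> {1..n}" for i
    using member_le_sum[of i "{1..n}" "\<lambda>i. i * s i"] s that by auto
  have "s i = 0" if "i \<notin> {1..m}" for i
  proof (rule ccontr)
    assume *: "s i \<noteq> 0"
    then have i: "i \<in> {1..n}" using s by auto
    have "i \<le> i * s i" using * by simp
    with le[OF i] have "i \<le> m" by linarith
    then show False using i that by auto
  qed
  moreover have "s i \<le> m" for i
  proof (cases "i \<in> {1..n}")
    case True
    then have "s i \<le> i * s i" by simp
    with le[OF True] show ?thesis by linarith
  next
    case False
    then show ?thesis using s by auto
  qed
  moreover have "(\<Sum>i=1..m. i * s i) = ?L"
    by (rule sum.mono_neutral_left) (use calculation assms in auto)
  ultimately show "s \<in> vecs m" using s by (auto simp: vecs_def)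
qed

lemma vecs_bound:
  assumes "s \<in> vecs n"
  shows "i * s i \<le> n"
proof (cases "i \<in> {1..n}")
  case True
  then show ?thesis
    using member_le_sum[of i "{1..n}" "\<lambda>i. i * s i"] assms by (auto simp: vecs_def)
qed (use assms in \<open>auto simp: vecs_def\<close>)

lemma vecs_subset_box: "m \<le> n \<Longrightarrow> vecs m \<subseteq> count_box n"
  by (auto simp: vecs_def count_box_def intro: order_trans)

lemma finite_vecs: "finite (vecs n)"
  using finite_subset[OF vecs_subset_box finite_box] by blast

lemma vecs_disjoint:
  assumes "s \<in> vecs m" "s \<in> vecs m'"
  shows "m = m'"
  using assms vecs_iff[of m "max m m'" s] vecs_iff[of m' "max m m'" s] by auto

lemma pwt_extend:
  assumes "m \<le> n" "s \<in> vecs m"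
  shows "pwt a m s = pwt a n s"
  unfolding pwt_def
  by (rule prod.mono_neutral_left) (use assms in \<open>auto simp: vecs_def\<close>)

section \<open>Changing one component count\<close>

lemma sum_fun_upd:
  fixes f :: "nat \<Rightarrow> 'a \<Rightarrow> nat"
  assumes "j \<in> {1..n}"
  shows "(\<Sum>i=1..n. f i ((s(j := x)) i)) + f j (s j) = (\<Sum>i=1..n. f i (s i)) + f j x"
proof -
  have "(\<Sum>i=1..n. f i (t i)) = f j (t j) + (\<Sum>i\<in>{1..n}-{j}. f i (t i))" for t
    by (rule sum.remove) (use assms in auto)
  from this[of s] this[of "s(j:=x)"] show ?thesis by simp
qed

text \<open>Stated without division, because the old factor at \<open>j\<close> may be zero.\<close>

lemma prod_fun_upd:
  fixes f :: "nat \<Rightarrow> 'a \<Rightarrow> real"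
  assumes "j \<in> {1..n}"
  shows "(\<Prod>i=1..n. f i ((s(j := x)) i)) * f j (s j) = (\<Prod>i=1..n. f i (s i)) * f j x"
proof -
  have "(\<Prod>i=1..n. f i (t i)) = f j (t j) * (\<Prod>i\<in>{1..n}-{j}. f i (t i))" for t
    by (rule prod.remove) (use assms in auto)
  from this[of s] this[of "s(j:=x)"] show ?thesis by simp
qed

lemma vecs_upd_iff:
  assumes "j \<in> {1..n}" "j * k \<le> n" "s j = k"
  shows "s \<in> vecs n \<longleftrightarrow> s(j := 0) \<in> vecs (n - j * k)"
proof -
  have "(\<Sum>i=1..n. i * (s(j := 0)) i) + j * k = (\<Sum>i=1..n. i * s i)"
    using sum_fun_upd[of j n "\<lambda>i x. i * x" s 0] assms by simp
  then show ?thesis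
    using assms by (subst (1 2) vecs_iff[of _ n]) auto
qed

lemma vecs_Suc_iff:
  assumes "j \<in> {1..n}"
  shows "s(j := Suc (s j)) \<in> vecs n \<longleftrightarrow> s \<in> vecs (n - j)"
proof -
  have "(\<Sum>i=1..n. i * (s(j := Suc (s j))) i) = (\<Sum>i=1..n. i * s i) + j"
    using sum_fun_upd[of j n "\<lambda>i x. i * x" s "Suc (s j)"] assms by (simp del: fun_upd_apply)
  then show ?thesis
    using assms by (subst (1 2) vecs_iff[of _ n]) auto
qed

text \<open>This is (k+1) x^(k+1)/(k+1)! = x x^k/k! in coordinate \<open>j\<close>. The product
  identity carries the factor \<open>a j ^ s j\<close>, which can be cancelled only if
  \<open>a j\<close> is nonzero; if \<open>a j = 0\<close>, both sides vanish.\<close>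

lemma pwt_Suc:
  assumes "j \<in> {1..n}"
  shows "real (Suc (s j)) * pwt a n (s(j := Suc (s j))) = a j * pwt a n s"
proof -
  have "pwt a n (s(j := Suc (s j))) * (a j ^ s j / fact (s j))
      = pwt a n s * (a j ^ Suc (s j) / fact (Suc (s j)))"
    using prod_fun_upd[of j n "\<lambda>i x. a i ^ x / fact x" s "Suc (s j)"] assms
    by (simp only: pwt_def)
  moreover have "pwt a n t = 0" if "a j = 0" "t j > 0" for t
    unfolding pwt_def by (rule prod_zero) (use assms that in \<open>auto intro!: bexI[of _ j]\<close>)
  ultimately show ?thesis
    using assms by (cases "a j = 0") (simp_all add: divide_simps mult_ac)
qed

text \<open>Size biasing: the factor \<open>s j\<close> kills vectors without a component of size
  \<open>j\<close>, and on the others removing one such component is a bijection onto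
  \<open>vecs (n - j)\<close>.\<close>

lemma sum_vecs_size_bias:
  assumes j: "j \<in> {1..n}"
  shows "(\<Sum>s\<in>vecs n. real (s j) * pwt a n s * \<phi> s)
       = a j * (\<Sum>s\<in>vecs (n - j). pwt a n s * \<phi> (s(j := Suc (s j))))"
proof -
  have "(\<Sum>s\<in>vecs n. real (s j) * pwt a n s * \<phi> s)
      = (\<Sum>s\<in>{s\<in>vecs n. 0 < s j}. real (s j) * pwt a n s * \<phi> s)"
    by (rule sum.mono_neutral_right) (auto simp: finite_vecs)
  also have "\<dots> = (\<Sum>s\<in>vecs (n - j). a j * (pwt a n s * \<phi> (s(j := Suc (s j)))))"
  proof (rule sum.reindex_bij_witness[where j = "\<lambda>s. s(j := s j - 1)" and i = "\<lambda>s. s(j := Suc (s j))"])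
    fix s assume s: "s \<in> {s\<in>vecs n. 0 < s j}"
    then have e: "(s(j := s j - 1))(j := Suc ((s(j := s j - 1)) j)) = s" by auto
    show "(s(j := s j - 1))(j := Suc ((s(j := s j - 1)) j)) = s" by (fact e)
    show "s(j := s j - 1) \<in> vecs (n - j)"
      using vecs_Suc_iff[OF j, of "s(j := s j - 1)"] s by (simp add: e)
    show "a j * (pwt a n (s(j := s j - 1)) * \<phi> ((s(j := s j - 1))(j := Suc ((s(j := s j - 1)) j))))
        = real (s j) * pwt a n s * \<phi> s"
      using pwt_Suc[OF j, of "s(j := s j - 1)" a] s by (simp add: e)
  qed (use vecs_Suc_iff[OF j] in auto)
  finally show ?thesis by (simp add: sum_distrib_left)
qed

section \<open>The total weights \<open>qf\<close> and \<open>qx\<close>\<close>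

definition qf :: "(nat \<Rightarrow> real) \<Rightarrow> nat \<Rightarrow> real" where
  "qf a n = (\<Sum>s\<in>vecs n. pwt a n s)"

definition qx :: "(nat \<Rightarrow> real) \<Rightarrow> nat \<Rightarrow> nat \<Rightarrow> real" where
  "qx a j n = (\<Sum>s\<in>{s\<in>vecs n. s j = 0}. pwt a n s)"

lemma qf_nonneg: "(\<And>i. a i \<ge> 0) \<Longrightarrow> qf a n \<ge> 0"
  unfolding qf_def by (intro sum_nonneg pwt_nonneg)

lemma qx_nonneg: "(\<And>i. a i \<ge> 0) \<Longrightarrow> qx a j n \<ge> 0"
  unfolding qx_def by (intro sum_nonneg pwt_nonneg)

text \<open>Vectors are grouped by the value \<open>k\<close> of \<open>s j\<close>, and resetting
  that coordinate to 0 leaves a vector counted by \<open>qx a j (n - j * k)\<close>. After division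
  by \<open>qf a n\<close> this is the law of the j-th count under the conditioned model.\<close>

lemma sum_vecs_marginal:
  assumes j: "j \<in> {1..n}"
  shows "(\<Sum>s\<in>vecs n. pwt a n s * \<phi> (s j))
       = (\<Sum>k\<in>{k. j * k \<le> n}. a j ^ k / fact k * \<phi> k * qx a j (n - j * k))"
proof -
  have fin: "finite {k. j * k \<le> n}"
    by (rule finite_subset[of _ "{..n}"]) (use j in \<open>auto intro: nat_mult_le_imp_le[of j]\<close>)
  have "(\<Sum>s\<in>vecs n. pwt a n s * \<phi> (s j))
      = (\<Sum>k\<in>{k. j * k \<le> n}. \<Sum>s\<in>{s\<in>vecs n. s j = k}. pwt a n s * \<phi> (s j))"
    by (rule sum.group[symmetric]) (auto simp: finite_vecs fin vecs_bound)
  also have "\<dots> = (\<Sum>k\<in>{k. j * k \<le> n}. a j ^ k / fact k * \<phi> k * qx a j (n - j * k))"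
  proof (rule sum.cong[OF refl])
    fix k assume "k \<in> {k. j * k \<le> n}"
    then have k: "j * k \<le> n" by simp
    have "(\<Sum>s\<in>{s\<in>vecs n. s j = k}. pwt a n s * \<phi> (s j))
        = (\<Sum>s\<in>{s\<in>vecs (n - j * k). s j = 0}. a j ^ k / fact k * \<phi> k * pwt a (n - j * k) s)"
    proof (rule sum.reindex_bij_witness[where j = "\<lambda>s. s(j := 0)" and i = "\<lambda>s. s(j := k)"])
      fix s assume "s \<in> {s\<in>vecs n. s j = k}"
      then have s: "s \<in> vecs n" "s j = k" by auto
      then have v: "s(j := 0) \<in> vecs (n - j * k)" using vecs_upd_iff[OF j k] by simp
      then show "s(j := 0) \<in> {s\<in>vecs (n - j * k). s j = 0}" by simp
      show "s(j := 0, j := k) = s" using s by auto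
      have "pwt a n (s(j := 0)) * (a j ^ k / fact k) = pwt a n s"
        using prod_fun_upd[of j n "\<lambda>i x. a i ^ x / fact x" s 0] j s by (simp add: pwt_def)
      then show "a j ^ k / fact k * \<phi> k * pwt a (n - j * k) (s(j := 0)) = pwt a n s * \<phi> (s j)"
        using pwt_extend[OF _ v, of n a] s by (simp flip: \<open>_ = pwt a n s\<close>)
    next
      fix s assume "s \<in> {s\<in>vecs (n - j * k). s j = 0}"
      then have s: "s \<in> vecs (n - j * k)" "s j = 0" by auto
      then show e: "s(j := k, j := 0) = s" by auto
      show "s(j := k) \<in> {s\<in>vecs n. s j = k}"
        using vecs_upd_iff[OF j k, of "s(j := k)"] s e by simp
    qed
    then show "(\<Sum>s\<in>{s\<in>vecs n. s j = k}. pwt a n s * \<phi> (s j))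
        = a j ^ k / fact k * \<phi> k * qx a j (n - j * k)"
      by (simp add: qx_def sum_distrib_left)
  qed
  finally show ?thesis .
qed

lemma sum_vecs_lengths: "s \<in> vecs n \<Longrightarrow> (\<Sum>j=1..n. real j * real (s j)) = real n"
  by (simp add: vecs_def flip: of_nat_mult of_nat_sum)

text \<open>Write \<open>n\<close> as the sum of the \<open>j * s j\<close> inside the sum over
  vectors and size-bias each term with the constant function 1.\<close>

lemma qf_recurrence: "real n * qf a n = (\<Sum>j=1..n. real j * a j * qf a (n - j))"
proof -
  have "real n * qf a n = (\<Sum>s\<in>vecs n. \<Sum>j=1..n. real j * (real (s j) * pwt a n s))"
    unfolding qf_def sum_distrib_left
    by (intro sum.cong refl) (simp only: sum_vecs_lengths flip: sum_distrib_right mult.assoc)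
  also have "\<dots> = (\<Sum>j=1..n. real j * (\<Sum>s\<in>vecs n. real (s j) * pwt a n s * 1))"
    by (subst sum.swap) (simp add: sum_distrib_left)
  also have "\<dots> = (\<Sum>j=1..n. real j * a j * qf a (n - j))"
  proof (rule sum.cong[OF refl])
    fix j assume j: "j \<in> {1..n}"
    have "(\<Sum>s\<in>vecs (n - j). pwt a n s) = qf a (n - j)"
      unfolding qf_def by (intro sum.cong refl pwt_extend[symmetric]) auto
    then show "real j * (\<Sum>s\<in>vecs n. real (s j) * pwt a n s * 1) = real j * a j * qf a (n - j)"
      using sum_vecs_size_bias[OF j, of a "\<lambda>_. 1"] by simp
  qed
  finally show ?thesis .
qed

text \<open>A Markov-type bound: the indicator of \<open>s j \<noteq> 0\<close> is at most
  \<open>s j\<close>, whose weighted sum is given by size biasing.\<close>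

lemma qf_le_qx:
  assumes "\<And>i. a i \<ge> 0" "j \<in> {1..n}"
  shows "qf a n \<le> qx a j n + a j * qf a (n - j)"
proof -
  have "qf a n = qx a j n + (\<Sum>s\<in>{s\<in>vecs n. s j \<noteq> 0}. pwt a n s)"
    unfolding qf_def qx_def
    by (subst sum.union_disjoint[symmetric]) (auto simp: finite_vecs intro!: sum.cong)
  also have "(\<Sum>s\<in>{s\<in>vecs n. s j \<noteq> 0}. pwt a n s) \<le> (\<Sum>s\<in>{s\<in>vecs n. s j \<noteq> 0}. real (s j) * pwt a n s * 1)"
    using pwt_nonneg[OF assms(1)] by (intro sum_mono) (auto simp: mult_le_cancel_right1 leD)
  also have "\<dots> \<le> (\<Sum>s\<in>vecs n. real (s j) * pwt a n s * 1)"
    by (rule sum_mono2) (auto simp: finite_vecs pwt_nonneg[OF assms(1)])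
  also have "\<dots> = a j * (\<Sum>s\<in>vecs (n - j). pwt a n s)"
    using sum_vecs_size_bias[OF assms(2), of a "\<lambda>_. 1"] by simp
  also have "(\<Sum>s\<in>vecs (n - j). pwt a n s) = qf a (n - j)"
    unfolding qf_def by (intro sum.cong refl pwt_extend[symmetric]) auto
  finally show ?thesis by simp
qed

section \<open>Truncated exponential series and the upper bound for \<open>qf\<close>\<close>

lemma trunc_exp_le:
  fixes x :: real
  assumes "x \<ge> 0"
  shows "(\<Sum>k\<le>n. x ^ k / fact k) \<le> exp x"
proof -
  have "(\<Sum>k<Suc n. x ^ k /\<^sub>R fact k) \<le> (\<Sum>k. x ^ k /\<^sub>R fact k)"
    by (rule sum_le_suminf[OF summable_exp_generic]) (use assms in auto)
  then show ?thesis
    by (simp only: exp_def lessThan_Suc_atMost scaleR_conv_of_real divide_inverse of_real_eq_id id_apply mult.commute)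
qed

lemma trunc_exp_ge_1:
  fixes x :: real
  assumes "x \<ge> 0"
  shows "(\<Sum>k\<le>n. x ^ k / fact k) \<ge> 1"
proof -
  have "(\<Sum>k\<in>{0}. x ^ k / fact k) \<le> (\<Sum>k\<le>n. x ^ k / fact k)"
    by (rule sum_mono2) (use assms in auto)
  then show ?thesis by simp
qed

lemma sum_box_pwt_le:
  assumes "\<And>i. a i \<ge> 0"
  shows "(\<Sum>s\<in>count_box n. pwt a n s) \<le> exp (\<Sum>j=1..n. a j)"
proof -
  have "(\<Sum>s\<in>count_box n. pwt a n s) = (\<Prod>i=1..n. \<Sum>k\<le>n. a i ^ k / fact k)"
    unfolding pwt_def by (rule sum_box_prod)
  also have "\<dots> \<le> (\<Prod>i=1..n. exp (a i))"
    by (intro prod_mono conjI trunc_exp_le sum_nonneg) (use assms in auto)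
  finally show ?thesis by (simp add: exp_sum)
qed

text \<open>The conditioning on the length disappears here: the sets \<open>vecs 0\<close>, ...,
  \<open>vecs (n - 1)\<close> are disjoint and all lie in the box, so a sum over every length below
  \<open>n\<close> is bounded by a sum over the product space.\<close>

lemma sum_vecs_le_box:
  assumes "\<And>s. f s \<ge> (0::real)"
  shows "(\<Sum>j=1..n. \<Sum>s\<in>vecs (n - j). f s) \<le> (\<Sum>s\<in>count_box n. f s)"
proof -
  have "(\<Sum>j=1..n. \<Sum>s\<in>vecs (n - j). f s) = (\<Sum>s\<in>(\<Union>j\<in>{1..n}. vecs (n - j)). f s)"
    by (rule sum.UNION_disjoint[symmetric]) (use finite_vecs vecs_disjoint in force)+
  also have "\<dots> \<le> (\<Sum>s\<in>count_box n. f s)"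
    by (rule sum_mono2) (use vecs_subset_box[of "n - _" n] assms finite_box in auto)
  finally show ?thesis .
qed

text \<open>In the recurrence each \<open>j * a j\<close> is at most \<Theta>, and what remains is
  the total weight of all lengths below \<open>n\<close>, at most that of the whole box.\<close>

lemma qf_upper:
  assumes a: "\<And>i. a i \<ge> 0" and ja: "\<And>j. j \<ge> 1 \<Longrightarrow> real j * a j \<le> \<Theta>"
  shows "real n * qf a n \<le> \<Theta> * exp (\<Sum>j=1..n. a j)"
proof -
  have \<Theta>: "\<Theta> \<ge> 0" using ja[of 1] a[of 1] by simp
  have "real n * qf a n \<le> (\<Sum>j=1..n. \<Theta> * qf a (n - j))"
    unfolding qf_recurrence by (intro sum_mono mult_right_mono ja qf_nonneg a) auto
  also have "\<dots> = \<Theta> * (\<Sum>j=1..n. \<Sum>s\<in>vecs (n - j). pwt a n s)"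
    unfolding sum_distrib_left[symmetric] qf_def
    by (intro arg_cong[of _ _ "(*) \<Theta>"] sum.cong refl pwt_extend) auto
  also have "\<dots> \<le> \<Theta> * exp (\<Sum>j=1..n. a j)"
    using sum_vecs_le_box[of "pwt a n" n] sum_box_pwt_le[of a n] pwt_nonneg[of a n] a \<Theta>
    by (intro mult_left_mono) (auto intro: order_trans)
  finally show ?thesis .
qed

section \<open>Counting assemblies by component vector\<close>

lemma partition_type_in_vecs:
  assumes "finite U" "partition_on U P"
  shows "(\<lambda>j. card {B \<in> P. card B = j}) \<in> vecs (card U)"
proof -
  have fP: "finite P" using assms by (rule finite_elements)
  have sub: "B \<subseteq> U" "B \<noteq> {}" if "B \<in> P" for B
    using assms that by (auto simp: partition_on_def)
  have cardB: "card B \<in> {1..card U}" if "B \<in> P" for B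
    using sub[OF that] assms(1) card_mono[of U B] finite_subset[of B U]
    by (auto simp: Suc_le_eq card_gt_0_iff)
  have "(\<Sum>i=1..card U. i * card {B \<in> P. card B = i}) = (\<Sum>i=1..card U. \<Sum>B\<in>{B \<in> P. card B = i}. card B)"
    by (intro sum.cong refl) simp
  also have "\<dots> = (\<Sum>B\<in>P. card B)"
    by (rule sum.group) (use fP cardB in auto)
  also have "\<dots> = card U"
    using assms sub by (subst card_Union_disjoint[symmetric])
      (auto simp: partition_on_def disjoint_def pairwise_def disjnt_def intro: finite_subset)
  finally show ?thesis
    using cardB by (subst vecs_iff[OF order_refl]) (auto simp: card_eq_0_iff)
qed

text \<open>The number of assemblies on \<open>U\<close> with component vector \<open>s\<close>:
  every partition is weighted by the number of ways to put structures on its blocks. The ground set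
  is arbitrary so that blocks can be removed from it.\<close>

definition typed_weight :: "(nat \<Rightarrow> nat) \<Rightarrow> 'a set \<Rightarrow> (nat \<Rightarrow> nat) \<Rightarrow> real" where
  "typed_weight g U s =
     (\<Sum>P | partition_on U P \<and> (\<lambda>j. card {B \<in> P. card B = j}) = s. \<Prod>B\<in>P. real (g (card B)))"

text \<open>Double counting of pairs (P, B) with \<open>B\<close> a block of size \<open>j\<close>
  in \<open>P\<close>. Choosing \<open>P\<close> first leaves \<open>s j\<close> blocks; choosing
  \<open>B\<close> first leaves a partition of \<open>U - B\<close> and \<open>g j\<close>
  structures on \<open>B\<close>.\<close>

lemma typed_weight_remove_block:
  fixes U :: "'a set"
  assumes fU: "finite U" and j: "j \<ge> 1" and sj: "s j \<ge> 1"
  shows "real (s j) * typed_weight g U s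
       = (\<Sum>B | B \<subseteq> U \<and> card B = j. real (g j) * typed_weight g (U - B) (s(j := s j - 1)))"
proof -
  define ty where "ty = (\<lambda>(P :: 'a set set) j. card {B \<in> P. card B = j})"
  define V where "V = (\<lambda>P :: 'a set set. \<Prod>B\<in>P. real (g (card B)))"
  have tw: "typed_weight g U s = (\<Sum>P | partition_on U P \<and> ty P = s. V P)" for U s
    unfolding typed_weight_def ty_def V_def ..
  have finp: "finite {P. partition_on W P \<and> Q P}" if "finite W" for W :: "'a set" and Q
    by (rule finite_subset[OF _ finitely_many_partition_on[OF that]]) auto
  have ty_insert: "ty (insert B P) = (ty P)(j := Suc (ty P j))"
    if "finite P" "B \<notin> P" "card B = j" for B P
  proof
    fix i
    have "{C \<in> insert B P. card C = i} = (if i = j then insert B {C \<in> P. card C = i} else {C \<in> P. card C = i})"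
      using that by auto
    then show "ty (insert B P) i = ((ty P)(j := Suc (ty P j))) i"
      using that by (auto simp: ty_def)
  qed
  \<comment> \<open>Since \<open>s j\<close> is at least 1, the truncated subtraction on naturals
    really inverts the successor.\<close>
  have upd: "t(j := Suc (t j)) = s \<longleftrightarrow> t = s(j := s j - 1)" for t
    using sj by (auto simp: fun_eq_iff)
  have "real (s j) * typed_weight g U s
      = (\<Sum>P | partition_on U P \<and> ty P = s. \<Sum>B\<in>{B \<in> P. card B = j}. V P)"
    unfolding tw sum_distrib_left by (intro sum.cong refl) (auto simp: ty_def)
  also have "\<dots> = (\<Sum>(P, B)\<in>Sigma {P. partition_on U P \<and> ty P = s} (\<lambda>P. {B \<in> P. card B = j}). V P)"
    by (rule sum.Sigma) (use fU finp[OF fU] finite_elements[OF fU] in auto)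
  also have "\<dots> = (\<Sum>(B, P)\<in>Sigma {B. B \<subseteq> U \<and> card B = j}
      (\<lambda>B. {P. partition_on (U - B) P \<and> ty P = s(j := s j - 1)}). real (g j) * V P)"
  proof (rule sum.reindex_bij_witness[where j = "\<lambda>(P, B). (B, P - {B})" and i = "\<lambda>(B, P). (insert B P, B)"])
    fix x assume "x \<in> Sigma {P. partition_on U P \<and> ty P = s} (\<lambda>P. {B \<in> P. card B = j})"
    then obtain P B where x: "x = (P, B)" and *: "partition_on U P" "ty P = s" "B \<in> P" "card B = j"
      by auto
    have e: "insert B (P - {B}) = P" using * by auto
    have fP: "finite P" using fU *(1) by (rule finite_elements)
    have dj: "disjnt B (\<Union>(P - {B}))"
      using *(1,3) by (force simp: partition_on_def disjoint_def disjnt_def)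
    show "(\<lambda>(B, P). (insert B P, B)) ((\<lambda>(P, B). (B, P - {B})) x) = x" using e x by simp
    have "partition_on (U - B) (P - {B})" "B \<subseteq> U"
      using partition_on_insert[OF dj, of U] *(1) e by auto
    moreover have "ty (P - {B}) = s(j := s j - 1)"
      using ty_insert[of "P - {B}" B] fP * e upd[of "ty (P - {B})"] by simp
    ultimately show "(\<lambda>(P, B). (B, P - {B})) x \<in> Sigma {B. B \<subseteq> U \<and> card B = j}
       (\<lambda>B. {P. partition_on (U - B) P \<and> ty P = s(j := s j - 1)})"
      using * x by auto
    have "real (g (card B)) * V (P - {B}) = V P"
      unfolding V_def using fP *(3) by (subst prod.remove[of P B]) auto
    then show "(case (\<lambda>(P, B). (B, P - {B})) x of (B, P) \<Rightarrow> real (g j) * V P) = (case x of (P, B) \<Rightarrow> V P)"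
      using x *(4) by simp
  next
    fix x assume "x \<in> Sigma {B. B \<subseteq> U \<and> card B = j}
       (\<lambda>B. {P. partition_on (U - B) P \<and> ty P = s(j := s j - 1)})"
    then obtain P B where x: "x = (B, P)"
      and *: "B \<subseteq> U" "card B = j" "partition_on (U - B) P" "ty P = s(j := s j - 1)"
      by auto
    have fP: "finite P" using fU *(3) by (auto intro: finite_elements)
    have B: "B \<noteq> {}" using j *(2) by auto
    have un: "\<Union>P = U - B" using *(3) by (simp add: partition_on_def)
    have nB: "B \<notin> P" using un B by auto
    show "(\<lambda>(P, B). (B, P - {B})) ((\<lambda>(B, P). (insert B P, B)) x) = x" using nB x by simp
    have "partition_on U (insert B P)"
      by (subst partition_on_insert) (use * B un in \<open>auto simp: disjnt_def\<close>)
    moreover have "ty (insert B P) = s"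
      using ty_insert[OF fP nB *(2)] *(4) upd[of "ty P"] by simp
    ultimately show "(\<lambda>(B, P). (insert B P, B)) x \<in> Sigma {P. partition_on U P \<and> ty P = s} (\<lambda>P. {B \<in> P. card B = j})"
      using x *(2) by auto
  qed
  also have "\<dots> = (\<Sum>B | B \<subseteq> U \<and> card B = j. \<Sum>P | partition_on (U - B) P \<and> ty P = s(j := s j - 1). real (g j) * V P)"
    by (rule sum.Sigma[symmetric]) (use fU finp in auto)
  finally show ?thesis by (simp add: tw sum_distrib_left)
qed

text \<open>Cauchy's formula, by induction on the size of \<open>U\<close>: remove a block of some
  size \<open>j\<close> that occurs in \<open>s\<close>. The \<open>n choose j\<close> positions
  combine with \<open>g j\<close> and \<open>fact (n - j)\<close> to
  \<open>fact n * lam g j\<close>, and \<open>pwt_Suc\<close> absorbs \<open>lam g j\<close> into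
  the weight.\<close>

lemma typed_weight_eq:
  fixes U :: "'a set"
  assumes "finite U" "s \<in> vecs (card U)"
  shows "typed_weight g U s = fact (card U) * weight g (card U) s"
  using assms
proof (induction "card U" arbitrary: U s rule: less_induct)
  case less
  show ?case
  proof (cases "card U = 0")
    case True
    then have U: "U = {}" using less.prems by simp
    have "s = (\<lambda>_. 0)" using less.prems(2) U by (auto simp: vecs_def fun_eq_iff)
    then have "{P. partition_on U P \<and> (\<lambda>j. card {B \<in> P. card B = j}) = s} = {{}}"
      using U by (auto simp: partition_on_empty)
    then show ?thesis using U by (simp add: typed_weight_def weight_def)
  next
    case False
    define n where "n = card U"
    have "(\<Sum>i=1..n. i * s i) \<noteq> 0" using less.prems(2) False by (simp add: vecs_def n_def)
    then obtain j where j: "j \<in> {1..n}" "s j \<noteq> 0"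
      by (elim sum.not_neutral_contains_not_neutral) auto
    define s' where "s' = s(j := s j - 1)"
    have s: "s = s'(j := Suc (s' j))" using j(2) by (auto simp: s'_def)
    have s': "s' \<in> vecs (n - j)"
      using vecs_Suc_iff[OF j(1), of s'] less.prems(2) s by (simp add: n_def)
    have "real (s j) * typed_weight g U s
        = (\<Sum>B | B \<subseteq> U \<and> card B = j. real (g j) * typed_weight g (U - B) s')"
      unfolding s'_def by (rule typed_weight_remove_block) (use less.prems j in auto)
    also have "\<dots> = (\<Sum>B | B \<subseteq> U \<and> card B = j. real (g j) * (fact (n - j) * weight g (n - j) s'))"
    proof (rule sum.cong[OF refl])
      fix B assume B: "B \<in> {B. B \<subseteq> U \<and> card B = j}"
      then have c: "card (U - B) = n - j"
        using less.prems(1) by (auto simp: card_Diff_subset finite_subset n_def)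
      have "typed_weight g (U - B) s' = fact (card (U - B)) * weight g (card (U - B)) s'"
        by (rule less.hyps) (use c j s' less.prems n_def in auto)
      then show "real (g j) * typed_weight g (U - B) s' = real (g j) * (fact (n - j) * weight g (n - j) s')"
        by (simp add: c)
    qed
    also have "\<dots> = real (n choose j) * (real (g j) * (fact (n - j) * weight g (n - j) s'))"
      using n_subsets[OF less.prems(1), of j] by (simp add: n_def)
    also have "\<dots> = fact n * (lam g j * weight g (n - j) s')"
      using j(1) by (simp add: lam_def binomial_fact field_simps)
    also have "lam g j * weight g (n - j) s' = real (s j) * weight g n s"
      using pwt_Suc[OF j(1), of s' "lam g"] pwt_extend[OF _ s', of n "lam g"] s
      by (simp add: weight_eq_pwt)
    finally show ?thesis using j(2) by (simp add: n_def)
  qed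
qed

text \<open>Under the uniform measure the vector of counts has law proportional to
  \<open>weight g n\<close>. Assemblies are summed first over the structures on a fixed partition,
  then over partitions grouped by type.\<close>

lemma sum_assemblies:
  fixes f :: "(nat \<Rightarrow> nat) \<Rightarrow> real"
  shows "(\<Sum>\<sigma>\<in>assemblies g n. f (\<lambda>j. kcnt j \<sigma>)) = fact n * (\<Sum>s\<in>vecs n. weight g n s * f s)"
proof -
  define ty where "ty = (\<lambda>(P :: nat set set) j. card {B \<in> P. card B = j})"
  define S where "S = (\<lambda>P :: nat set set. {c. (\<forall>B\<in>P. c B < g (card B)) \<and> (\<forall>B. B \<notin> P \<longrightarrow> c B = (0::nat))})"
  have asm: "assemblies g n = Sigma {P. partition_on {0..<n} P} S"
    by (auto simp: assemblies_def S_def)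
  have fin: "finite {P. partition_on {0..<n} P}" by (rule finitely_many_partition_on) simp
  \<comment> \<open>Structure functions are 0 off \<open>P\<close>, whereas \<open>PiE\<close> uses
    \<open>undefined\<close> there; restriction translates between the two conventions.\<close>
  have bij: "bij_betw (\<lambda>c. restrict c P) (S P) (PiE P (\<lambda>B. {..<g (card B)}))" for P
    by (rule bij_betw_byWitness[where f' = "\<lambda>c B. if B \<in> P then c B else 0"])
      (auto simp: S_def fun_eq_iff restrict_def PiE_def extensional_def)
  have S: "card (S P) = (\<Prod>B\<in>P. g (card B)) \<and> finite (S P)" if "partition_on {0..<n} P" for P
  proof -
    have fP: "finite P" using finite_elements[OF _ that] by simp
    then show ?thesis
      using bij_betw_same_card[OF bij[of P]] bij_betw_finite[OF bij[of P]]
        finite_PiE[OF fP, of "\<lambda>B. {..<g (card B)}"]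
      by (simp add: card_PiE)
  qed
  have "(\<Sum>\<sigma>\<in>assemblies g n. f (\<lambda>j. kcnt j \<sigma>)) = (\<Sum>(P, c)\<in>Sigma {P. partition_on {0..<n} P} S. f (ty P))"
    unfolding asm by (intro sum.cong refl) (auto simp: kcnt_def ty_def)
  also have "\<dots> = (\<Sum>P | partition_on {0..<n} P. \<Sum>c\<in>S P. f (ty P))"
    by (rule sum.Sigma[symmetric]) (use fin S in auto)
  also have "\<dots> = (\<Sum>P | partition_on {0..<n} P. (\<Prod>B\<in>P. real (g (card B))) * f (ty P))"
    by (intro sum.cong refl) (simp add: S)
  also have "\<dots> = (\<Sum>s\<in>vecs n. \<Sum>P\<in>{P\<in>{P. partition_on {0..<n} P}. ty P = s}. (\<Prod>B\<in>P. real (g (card B))) * f (ty P))"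
    by (rule sum.group[symmetric])
      (use fin finite_vecs partition_type_in_vecs[of "{0..<n}"] in \<open>auto simp: ty_def\<close>)
  also have "\<dots> = (\<Sum>s\<in>vecs n. typed_weight g {0..<n} s * f s)"
    unfolding typed_weight_def sum_distrib_right ty_def by (intro sum.cong refl) auto
  also have "\<dots> = (\<Sum>s\<in>vecs n. fact n * weight g n s * f s)"
    by (intro sum.cong refl) (simp add: typed_weight_eq)
  finally show ?thesis by (simp add: sum_distrib_left mult_ac)
qed

lemma card_assemblies: "real (card (assemblies g n)) = fact n * Qf g n"
  using sum_assemblies[of "\<lambda>_. 1" g n] by (simp add: Qf_def)

lemma En_eq: "En g n (\<lambda>\<sigma>. f (\<lambda>j. kcnt j \<sigma>)) = (\<Sum>s\<in>vecs n. weight g n s * f s) / Qf g n"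
  unfolding En_def card_assemblies sum_assemblies[of f] by simp

section \<open>Comparison with independent counts\<close>

text \<open>The box sum factorizes over coordinates, and each factor other than the j-th is a
  truncated exponential series.\<close>

lemma sum_box_marginal_le:
  assumes a: "\<And>i. a i \<ge> 0" and j: "j \<in> {1..n}" and \<phi>: "\<And>k. \<phi> k \<ge> 0"
  shows "(\<Sum>s\<in>count_box n. pwt a n s * \<phi> (s j))
       \<le> exp (\<Sum>i=1..n. a i) * (\<Sum>k\<le>n. a j ^ k / fact k * \<phi> k)"
proof -
  define f where "f i k = a i ^ k / fact k * (if i = j then \<phi> k else 1)" for i k
  define R where "R = (\<Sum>k\<le>n. a j ^ k / fact k * \<phi> k)"
  have R: "R \<ge> 0" unfolding R_def by (intro sum_nonneg mult_nonneg_nonneg) (use a \<phi> in auto)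
  have rem: "(\<Prod>i=1..n. u i) = u j * (\<Prod>i\<in>{1..n}-{j}. u i)" for u :: "nat \<Rightarrow> real"
    by (rule prod.remove) (use j in auto)
  have "(\<Sum>s\<in>count_box n. pwt a n s * \<phi> (s j)) = (\<Sum>s\<in>count_box n. \<Prod>i=1..n. f i (s i))"
    unfolding pwt_def f_def prod.distrib using j by (intro sum.cong refl) (subst prod.delta, auto)
  also have "\<dots> = (\<Prod>i=1..n. \<Sum>k\<le>n. f i k)" by (rule sum_box_prod)
  also have "\<dots> = R * (\<Prod>i\<in>{1..n}-{j}. \<Sum>k\<le>n. a i ^ k / fact k)"
    unfolding rem by (simp add: f_def R_def)
  \<comment> \<open>The extra factor \<open>exp (a j)\<close>, at least 1, is inserted so that the
    exponentials combine to the full sum over \<open>{1..n}\<close>.\<close>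
  also have "\<dots> \<le> R * (exp (a j) * (\<Prod>i\<in>{1..n}-{j}. exp (a i)))"
  proof (rule mult_left_mono[OF _ R])
    have "(\<Prod>i\<in>{1..n}-{j}. \<Sum>k\<le>n. a i ^ k / fact k) \<le> (\<Prod>i\<in>{1..n}-{j}. exp (a i))"
      by (intro prod_mono conjI trunc_exp_le sum_nonneg) (use a in auto)
    also have "\<dots> \<le> exp (a j) * (\<Prod>i\<in>{1..n}-{j}. exp (a i))"
      using a[of j] mult_right_mono[of 1 "exp (a j)" "\<Prod>i\<in>{1..n}-{j}. exp (a i)"]
      by (simp add: prod_nonneg)
    finally show "(\<Prod>i\<in>{1..n}-{j}. \<Sum>k\<le>n. a i ^ k / fact k) \<le> exp (a j) * (\<Prod>i\<in>{1..n}-{j}. exp (a i))" .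
  qed
  also have "exp (a j) * (\<Prod>i\<in>{1..n}-{j}. exp (a i)) = exp (\<Sum>i=1..n. a i)"
    by (simp only: exp_sum finite_atLeastAtMost rem)
  finally show ?thesis by (simp add: R_def mult.commute)
qed

text \<open>Independence: in the factorized sum the i-th factor is the vanishing mean of
  \<open>u\<close>.\<close>

lemma sum_box_orthogonal:
  assumes ij: "i \<in> {1..n}" "j \<noteq> i" and zero: "(\<Sum>k\<le>n. a i ^ k / fact k * u k) = 0"
    and j: "j \<in> {1..n}"
  shows "(\<Sum>s\<in>count_box n. pwt a n s * (u (s i) * v (s j))) = (0::real)"
proof -
  define f where
    "f l k = a l ^ k / fact k * ((if l = i then u k else 1) * (if l = j then v k else 1))" for l k
  have "(\<Sum>s\<in>count_box n. pwt a n s * (u (s i) * v (s j))) = (\<Sum>s\<in>count_box n. \<Prod>l=1..n. f l (s l))"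
    unfolding pwt_def f_def prod.distrib using ij j
    by (intro sum.cong refl) (subst (1 2) prod.delta, auto)
  also have "\<dots> = (\<Prod>l=1..n. \<Sum>k\<le>n. f l k)" by (rule sum_box_prod)
  also have "\<dots> = 0"
    by (rule prod_zero) (use ij zero in \<open>auto intro!: bexI[of _ i] simp: f_def\<close>)
  finally show ?thesis .
qed

text \<open>With \<open>c\<close> the sum of the coordinate means, independence removes the mixed
  terms of the square, and each variance is at most the corresponding second moment.\<close>

lemma count_box_variance_le:
  fixes Y :: "nat \<Rightarrow> nat \<Rightarrow> real"
  assumes a: "\<And>i. a i \<ge> 0"
  obtains c where "(\<Sum>s\<in>count_box n. pwt a n s * ((\<Sum>j=1..n. Y j (s j)) - c)\<^sup>2)
    \<le> exp (\<Sum>j=1..n. a j) * (\<Sum>j=1..n. \<Sum>k\<le>n. a j ^ k / fact k * (Y j k)\<^sup>2)"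
proof
  \<comment> \<open>Because counts are truncated at \<open>n\<close>, the means must be normalized
    by \<open>Z j\<close> rather than by \<open>exp (a j)\<close> for the centred functions to have
    mean exactly zero.\<close>
  define Z where "Z j = (\<Sum>k\<le>n. a j ^ k / fact k)" for j
  define m where "m j = (\<Sum>k\<le>n. a j ^ k / fact k * Y j k) / Z j" for j
  define y where "y j k = Y j k - m j" for j k
  have Z: "Z j \<ge> 1" for j unfolding Z_def by (rule trunc_exp_ge_1[OF a])
  have m: "(\<Sum>k\<le>n. a j ^ k / fact k * Y j k) = m j * Z j" for j
    using Z[of j] by (simp add: m_def)
  have y0: "(\<Sum>k\<le>n. a j ^ k / fact k * y j k) = 0" for j
    unfolding y_def right_diff_distrib sum_subtractf m
    by (simp add: Z_def sum_distrib_left mult.commute)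
  have y2: "(\<Sum>k\<le>n. a j ^ k / fact k * (y j k)\<^sup>2) \<le> (\<Sum>k\<le>n. a j ^ k / fact k * (Y j k)\<^sup>2)" for j
  proof -
    have "w * (Y j k)\<^sup>2 = w * (y j k)\<^sup>2 + 2 * m j * (w * y j k) + (m j)\<^sup>2 * w" for w k
      by (simp add: y_def power2_eq_square algebra_simps)
    then have "(\<Sum>k\<le>n. a j ^ k / fact k * (Y j k)\<^sup>2)
        = (\<Sum>k\<le>n. a j ^ k / fact k * (y j k)\<^sup>2 + 2 * m j * (a j ^ k / fact k * y j k) + (m j)\<^sup>2 * (a j ^ k / fact k))"
      by (intro sum.cong refl)
    also have "\<dots> = (\<Sum>k\<le>n. a j ^ k / fact k * (y j k)\<^sup>2) + 2 * m j * 0 + (m j)\<^sup>2 * Z j"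
      unfolding sum.distrib sum_distrib_left[symmetric] y0 Z_def ..
    finally show ?thesis using Z[of j] by (simp add: mult_nonneg_nonneg)
  qed
  have "(\<Sum>j=1..n. Y j (s j)) - (\<Sum>j=1..n. m j) = (\<Sum>j=1..n. y j (s j))" for s
    by (simp add: y_def sum_subtractf)
  then have yS: "((\<Sum>j=1..n. Y j (s j)) - (\<Sum>j=1..n. m j))\<^sup>2 = (\<Sum>i=1..n. \<Sum>j=1..n. y i (s i) * y j (s j))" for s
    by (simp only: power2_eq_square sum_product)
  have "(\<Sum>s\<in>count_box n. pwt a n s * ((\<Sum>j=1..n. Y j (s j)) - (\<Sum>j=1..n. m j))\<^sup>2)
      = (\<Sum>s\<in>count_box n. \<Sum>i=1..n. \<Sum>j=1..n. pwt a n s * (y i (s i) * y j (s j)))"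
    by (simp only: yS sum_distrib_left)
  also have "\<dots> = (\<Sum>i=1..n. \<Sum>s\<in>count_box n. \<Sum>j=1..n. pwt a n s * (y i (s i) * y j (s j)))"
    by (rule sum.swap)
  also have "\<dots> = (\<Sum>i=1..n. \<Sum>j=1..n. \<Sum>s\<in>count_box n. pwt a n s * (y i (s i) * y j (s j)))"
    by (rule sum.cong[OF refl], rule sum.swap)
  also have "\<dots> = (\<Sum>i=1..n. \<Sum>j=1..n. if j = i then \<Sum>s\<in>count_box n. pwt a n s * (y i (s i))\<^sup>2 else 0)"
  proof (intro sum.cong refl)
    fix i j assume "i \<in> {1..n}" "j \<in> {1..n}"
    then show "(\<Sum>s\<in>count_box n. pwt a n s * (y i (s i) * y j (s j)))
        = (if j = i then \<Sum>s\<in>count_box n. pwt a n s * (y i (s i))\<^sup>2 else 0)"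
      using sum_box_orthogonal[of i n j a "y i" "y j"] y0[of i] by (cases "j = i") (simp_all add: power2_eq_square)
  qed
  also have "\<dots> = (\<Sum>i=1..n. \<Sum>s\<in>count_box n. pwt a n s * (y i (s i))\<^sup>2)"
    by (intro sum.cong refl) (simp add: sum.delta')
  also have "\<dots> \<le> (\<Sum>i=1..n. exp (\<Sum>j=1..n. a j) * (\<Sum>k\<le>n. a i ^ k / fact k * (Y i k)\<^sup>2))"
  proof (rule sum_mono)
    fix i assume i: "i \<in> {1..n}"
    have "(\<Sum>s\<in>count_box n. pwt a n s * (y i (s i))\<^sup>2)
        \<le> exp (\<Sum>j=1..n. a j) * (\<Sum>k\<le>n. a i ^ k / fact k * (y i k)\<^sup>2)"
      using sum_box_marginal_le[OF a i, of "\<lambda>k. (y i k)\<^sup>2"] by simp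
    also have "\<dots> \<le> exp (\<Sum>j=1..n. a j) * (\<Sum>k\<le>n. a i ^ k / fact k * (Y i k)\<^sup>2)"
      by (intro mult_left_mono y2) simp
    finally show "(\<Sum>s\<in>count_box n. pwt a n s * (y i (s i))\<^sup>2)
        \<le> exp (\<Sum>j=1..n. a j) * (\<Sum>k\<le>n. a i ^ k / fact k * (Y i k)\<^sup>2)" .
  qed
  finally show "(\<Sum>s\<in>count_box n. pwt a n s * ((\<Sum>j=1..n. Y j (s j)) - (\<Sum>j=1..n. m j))\<^sup>2)
    \<le> exp (\<Sum>j=1..n. a j) * (\<Sum>j=1..n. \<Sum>k\<le>n. a j ^ k / fact k * (Y j k)\<^sup>2)"
    by (simp add: sum_distrib_left)
qed

lemma square_sum3_le: "(x + y - z)\<^sup>2 \<le> 3 * x\<^sup>2 + 3 * y\<^sup>2 + 3 * (z::real)\<^sup>2"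
proof -
  have "3 * x\<^sup>2 + 3 * y\<^sup>2 + 3 * z\<^sup>2 - (x + y - z)\<^sup>2 = (x - y)\<^sup>2 + (x + z)\<^sup>2 + (y + z)\<^sup>2"
    by (simp add: power2_eq_square algebra_simps)
  then show ?thesis by (smt (verit) zero_le_power2)
qed

text \<open>Passage from the conditioned to the independent model. With \<open>c\<close> the centre
  from the box, \<open>n\<close> is written as the sum of the \<open>j * s j\<close> and a component
  of size \<open>j\<close> is removed; this changes the additive function only in its j-th term.
  Summing over \<open>j\<close> then yields sums over all lengths below \<open>n\<close>, which the
  box controls.\<close>

lemma vecs_second_moment_le:
  fixes Y :: "nat \<Rightarrow> nat \<Rightarrow> real"
  assumes a: "\<And>i. a i \<ge> 0" and ja: "\<And>j. j \<ge> 1 \<Longrightarrow> real j * a j \<le> \<Theta>"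
  obtains c where "real n * (\<Sum>s\<in>vecs n. pwt a n s * ((\<Sum>j=1..n. Y j (s j)) - c)\<^sup>2)
    \<le> 6 * \<Theta> * exp (\<Sum>j=1..n. a j) * (\<Sum>j=1..n. \<Sum>k\<le>n. a j ^ k / fact k * (Y j k)\<^sup>2)
      + 3 * real n * (\<Sum>s\<in>vecs n. pwt a n s * (\<Sum>j=1..n. (Y j (s j))\<^sup>2))"
proof -
  define E where "E = exp (\<Sum>j=1..n. a j)"
  define M where "M j = (\<Sum>k\<le>n. a j ^ k / fact k * (Y j k)\<^sup>2)" for j
  obtain c where c: "(\<Sum>s\<in>count_box n. pwt a n s * ((\<Sum>j=1..n. Y j (s j)) - c)\<^sup>2) \<le> E * (\<Sum>j=1..n. M j)"
    unfolding E_def M_def by (rule count_box_variance_le[OF a, where n = n and Y = Y])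
  define F where "F s = (\<Sum>j=1..n. Y j (s j)) - c" for s
  note w = pwt_nonneg[OF a]
  have \<Theta>: "\<Theta> \<ge> 0" using ja[of 1] a[of 1] by simp
  have "real n * (\<Sum>s\<in>vecs n. pwt a n s * (F s)\<^sup>2)
      = (\<Sum>s\<in>vecs n. \<Sum>j=1..n. real j * (real (s j) * pwt a n s * (F s)\<^sup>2))"
    unfolding sum_distrib_left
    by (intro sum.cong refl)
      (simp only: sum_vecs_lengths flip: sum_distrib_right mult.assoc)
  also have "\<dots> = (\<Sum>j=1..n. real j * (\<Sum>s\<in>vecs n. real (s j) * pwt a n s * (F s)\<^sup>2))"
    by (subst sum.swap) (simp add: sum_distrib_left)
  also have "\<dots> \<le> (\<Sum>j=1..n. 3 * \<Theta> * (\<Sum>s\<in>vecs (n - j). pwt a n s * (F s)\<^sup>2)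
      + 3 * (\<Sum>s\<in>vecs n. pwt a n s * (real n * (Y j (s j))\<^sup>2)) + 3 * \<Theta> * (E * M j))"
  proof (rule sum_mono)
    fix j assume j: "j \<in> {1..n}"
    define S1 where "S1 = (\<Sum>s\<in>vecs (n - j). pwt a n s * (F s)\<^sup>2)"
    define S2 where "S2 = (\<Sum>s\<in>vecs n. real (s j) * pwt a n s * (Y j (s j))\<^sup>2)"
    define S3 where "S3 = (\<Sum>s\<in>vecs (n - j). pwt a n s * (Y j (s j))\<^sup>2)"
    have F: "F (s(j := Suc (s j))) = F s + Y j (Suc (s j)) - Y j (s j)" for s
    proof -
      have "(\<Sum>i=1..n. Y i (t i)) = Y j (t j) + (\<Sum>i\<in>{1..n}-{j}. Y i (t i))" for t
        by (rule sum.remove) (use j in auto)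
      from this[of s] this[of "s(j := Suc (s j))"] show ?thesis by (simp add: F_def)
    qed
    have "(\<Sum>s\<in>vecs n. real (s j) * pwt a n s * (F s)\<^sup>2)
        = a j * (\<Sum>s\<in>vecs (n - j). pwt a n s * (F (s(j := Suc (s j))))\<^sup>2)"
      by (rule sum_vecs_size_bias[OF j])
    also have "\<dots> \<le> a j * (\<Sum>s\<in>vecs (n - j). pwt a n s *
        (3 * (F s)\<^sup>2 + 3 * (Y j (Suc (s j)))\<^sup>2 + 3 * (Y j (s j))\<^sup>2))"
      unfolding F by (intro mult_left_mono sum_mono square_sum3_le w a)
    also have "\<dots> = 3 * (a j * S1) + 3 * (a j * (\<Sum>s\<in>vecs (n - j). pwt a n s * (Y j (Suc (s j)))\<^sup>2))
        + 3 * (a j * S3)"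
      by (simp add: S1_def S3_def distrib_left sum.distrib sum_distrib_left mult_ac)
    \<comment> \<open>Size biasing is undone for this term: it returns to \<open>vecs n\<close>,
      where \<open>j * s j\<close> is at most \<open>n\<close>, and yields the second summand of the
      bound.\<close>
    also have "a j * (\<Sum>s\<in>vecs (n - j). pwt a n s * (Y j (Suc (s j)))\<^sup>2) = S2"
      unfolding S2_def using sum_vecs_size_bias[OF j, of a "\<lambda>s. (Y j (s j))\<^sup>2"] by simp
    finally have 1: "(\<Sum>s\<in>vecs n. real (s j) * pwt a n s * (F s)\<^sup>2)
        \<le> 3 * (a j * S1) + 3 * S2 + 3 * (a j * S3)" .
    have S1: "S1 \<ge> 0" and S3: "S3 \<ge> 0"
      unfolding S1_def S3_def by (auto intro!: sum_nonneg w mult_nonneg_nonneg)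
    have S3_le: "S3 \<le> E * M j"
    proof -
      have "S3 \<le> (\<Sum>s\<in>count_box n. pwt a n s * (Y j (s j))\<^sup>2)"
        unfolding S3_def
        by (rule sum_mono2) (use finite_box vecs_subset_box[of "n - j" n] w in auto)
      also have "\<dots> \<le> E * M j"
        unfolding E_def M_def by (rule sum_box_marginal_le[OF a j]) simp
      finally show ?thesis .
    qed
    have S2_le: "real j * S2 \<le> (\<Sum>s\<in>vecs n. pwt a n s * (real n * (Y j (s j))\<^sup>2))"
      unfolding S2_def sum_distrib_left
    proof (rule sum_mono)
      fix s assume "s \<in> vecs n"
      then have "real j * real (s j) \<le> real n"
        using vecs_bound[of s n j] by (simp flip: of_nat_mult)
      then have "(real j * real (s j)) * (pwt a n s * (Y j (s j))\<^sup>2) \<le> real n * (pwt a n s * (Y j (s j))\<^sup>2)"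
        by (intro mult_right_mono mult_nonneg_nonneg w) auto
      then show "real j * (real (s j) * pwt a n s * (Y j (s j))\<^sup>2) \<le> pwt a n s * (real n * (Y j (s j))\<^sup>2)"
        by (simp add: mult_ac)
    qed
    have ja': "real j * a j \<le> \<Theta>" using ja[of j] j by simp
    have "real j * (\<Sum>s\<in>vecs n. real (s j) * pwt a n s * (F s)\<^sup>2)
        \<le> real j * (3 * (a j * S1) + 3 * S2 + 3 * (a j * S3))"
      by (intro mult_left_mono 1) simp
    also have "\<dots> = 3 * ((real j * a j) * S1) + 3 * (real j * S2) + 3 * ((real j * a j) * S3)"
      by (simp add: algebra_simps)
    also have "\<dots> \<le> 3 * (\<Theta> * S1) + 3 * (\<Sum>s\<in>vecs n. pwt a n s * (real n * (Y j (s j))\<^sup>2))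
        + 3 * (\<Theta> * (E * M j))"
      using mult_right_mono[OF ja' S1] S2_le
        order_trans[OF mult_right_mono[OF ja' S3] mult_left_mono[OF S3_le \<Theta>]]
      by linarith
    finally show "real j * (\<Sum>s\<in>vecs n. real (s j) * pwt a n s * (F s)\<^sup>2)
        \<le> 3 * \<Theta> * (\<Sum>s\<in>vecs (n - j). pwt a n s * (F s)\<^sup>2)
          + 3 * (\<Sum>s\<in>vecs n. pwt a n s * (real n * (Y j (s j))\<^sup>2)) + 3 * \<Theta> * (E * M j)"
      by (simp add: S1_def)
  qed
  also have "\<dots> = 3 * \<Theta> * (\<Sum>j=1..n. \<Sum>s\<in>vecs (n - j). pwt a n s * (F s)\<^sup>2)
      + 3 * (\<Sum>j=1..n. \<Sum>s\<in>vecs n. pwt a n s * (real n * (Y j (s j))\<^sup>2)) + 3 * \<Theta> * (E * (\<Sum>j=1..n. M j))"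
    by (simp only: sum.distrib sum_distrib_left)
  finally have le: "real n * (\<Sum>s\<in>vecs n. pwt a n s * (F s)\<^sup>2) \<le> \<dots>" .
  have "(\<Sum>j=1..n. \<Sum>s\<in>vecs n. pwt a n s * (real n * (Y j (s j))\<^sup>2))
      = real n * (\<Sum>s\<in>vecs n. pwt a n s * (\<Sum>j=1..n. (Y j (s j))\<^sup>2))"
    by (subst sum.swap) (simp add: sum_distrib_left mult_ac)
  moreover have "(\<Sum>j=1..n. \<Sum>s\<in>vecs (n - j). pwt a n s * (F s)\<^sup>2) \<le> E * (\<Sum>j=1..n. M j)"
    by (rule order_trans[OF sum_vecs_le_box]) (use w c in \<open>auto simp: F_def\<close>)
  then have "3 * \<Theta> * (\<Sum>j=1..n. \<Sum>s\<in>vecs (n - j). pwt a n s * (F s)\<^sup>2) \<le> 3 * \<Theta> * (E * (\<Sum>j=1..n. M j))"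
    by (rule mult_left_mono) (use \<Theta> in simp)
  ultimately have "real n * (\<Sum>s\<in>vecs n. pwt a n s * (F s)\<^sup>2)
    \<le> 6 * \<Theta> * E * (\<Sum>j=1..n. M j) + 3 * real n * (\<Sum>s\<in>vecs n. pwt a n s * (\<Sum>j=1..n. (Y j (s j))\<^sup>2))"
    using le by linarith
  then show thesis
    by (intro that[of c]) (simp add: F_def E_def M_def)
qed

section \<open>The variance bound\<close>

text \<open>The conditioned law of a count is compared with the Poisson law from below. With m = n -
  jk, the assumptions give m \<ge> 2n/3 and 2j \<le> m. The threshold on \<open>j\<close> makes
  \<open>a j * qf a (m - j)\<close> at most half of \<open>qf a m\<close>, so
  \<open>qx a j m\<close> is at least the other half. Finally \<open>qf a m\<close> and
  \<open>qf a n\<close> are comparable by the upper and lower bounds for \<open>qf\<close>.\<close>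

lemma qx_lower:
  assumes a: "\<And>i. a i \<ge> 0" and ja: "\<And>j. j \<ge> 1 \<Longrightarrow> real j * a j \<le> \<Theta>"
    and pos: "\<Theta> > 0" "\<theta>' > 0"
    and low: "\<And>m. m \<ge> 1 \<Longrightarrow> \<theta>' * exp (\<Sum>j=1..m. a j) \<le> real m * qf a m"
    and j: "j \<ge> 1" "4 * \<Theta>\<^sup>2 / \<theta>' \<le> real j" and k: "k \<ge> 1" "3 * (j * k) \<le> n"
  shows "\<theta>' * exp (- \<Theta>) / (2 * \<Theta>) * qf a n \<le> qx a j (n - j * k)"
proof -
  define m where "m = n - j * k"
  define A where "A l = (\<Sum>j=1..l. a j)" for l
  have jk: "j \<le> j * k" using k by simp
  have m: "3 * m \<ge> 2 * n" "m \<le> n" using k by (auto simp: m_def)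
  have jm: "2 * j \<le> m" and n1: "n \<ge> 1" using jk k j m by linarith+
  then have m1: "m \<ge> 1" using j by linarith
  have A_mono: "A l \<le> A l'" if "l \<le> l'" for l l'
    unfolding A_def by (rule sum_mono2) (use that a in auto)
  have aj: "a j \<le> \<Theta> / real j" using ja[OF j(1)] j(1) by (simp add: field_simps)
  have half: "a j * qf a (m - j) \<le> qf a m / 2"
  proof -
    have "real m / 2 * qf a (m - j) \<le> real (m - j) * qf a (m - j)"
      by (intro mult_right_mono qf_nonneg a) (use jm in simp)
    also have "\<dots> \<le> \<Theta> * exp (A (m - j))"
      unfolding A_def by (rule qf_upper[OF a ja])
    also have "\<dots> \<le> \<Theta> * exp (A m)"
      using A_mono[of "m - j" m] pos by simp
    finally have "real m * qf a (m - j) \<le> 2 * \<Theta> * exp (A m)" by simp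
    then have "\<theta>' * (real m * qf a (m - j)) \<le> \<theta>' * (2 * \<Theta> * exp (A m))"
      using pos by (intro mult_left_mono) auto
    also have "\<dots> = 2 * \<Theta> * (\<theta>' * exp (A m))" by simp
    also have "\<dots> \<le> 2 * \<Theta> * (real m * qf a m)"
      unfolding A_def by (intro mult_left_mono low m1) (use pos in simp)
    finally have "real m * (\<theta>' * qf a (m - j)) \<le> real m * (2 * \<Theta> * qf a m)"
      by (simp add: mult_ac)
    then have 1: "\<theta>' * qf a (m - j) \<le> 2 * \<Theta> * qf a m" using m1 by simp
    have "a j * (\<theta>' * qf a (m - j)) \<le> \<Theta> / real j * (2 * \<Theta> * qf a m)"
      by (intro mult_mono aj 1) (use pos a qf_nonneg[OF a] in auto)
    also have "\<dots> = 2 * \<Theta>\<^sup>2 / real j * qf a m" by (simp add: power2_eq_square)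
    also have "\<dots> \<le> \<theta>' / 2 * qf a m"
    proof (rule mult_right_mono[OF _ qf_nonneg[OF a]])
      show "2 * \<Theta>\<^sup>2 / real j \<le> \<theta>' / 2" using j pos by (simp add: field_simps)
    qed
    finally have "\<theta>' * (a j * qf a (m - j)) \<le> \<theta>' * (qf a m / 2)" by (simp add: mult_ac)
    then show ?thesis using pos by simp
  qed
  have qx: "qf a m \<le> 2 * qx a j m"
    using qf_le_qx[where a = a and j = j and n = m] half jm j a by auto
  \<comment> \<open>There are n - m \<le> m indices above \<open>m\<close>, and each of their
    parameters is at most \<Theta>/m.\<close>
  have "A n \<le> A m + \<Theta>"
  proof -
    have "A n = A m + (\<Sum>i\<in>{m<..n}. a i)"
      unfolding A_def using m by (subst sum.union_disjoint[symmetric]) (auto intro!: sum.cong)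
    also have "(\<Sum>i\<in>{m<..n}. a i) \<le> (\<Sum>i\<in>{m<..n}. \<Theta> / real m)"
    proof (rule sum_mono)
      fix i assume i: "i \<in> {m<..n}"
      then have "real m * a i \<le> real i * a i" by (intro mult_right_mono a) auto
      then show "a i \<le> \<Theta> / real m" using ja[of i] i m1 by (simp add: field_simps)
    qed
    also have "\<dots> = real (n - m) * (\<Theta> / real m)" by simp
    also have "\<dots> \<le> real m * (\<Theta> / real m)"
      by (intro mult_right_mono) (use m pos in auto)
    finally show ?thesis using m1 by simp
  qed
  then have "exp (A n) \<le> exp (A m) * exp \<Theta>" by (simp flip: exp_add)
  then have "exp (- \<Theta>) * exp (A n) \<le> exp (A m)" by (simp add: exp_minus field_simps)
  note e = mult_left_mono[OF this, of "\<theta>'"]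
  have "real n * (\<theta>' * exp (- \<Theta>) * qf a n) = \<theta>' * exp (- \<Theta>) * (real n * qf a n)" by simp
  also have "\<dots> \<le> \<theta>' * exp (- \<Theta>) * (\<Theta> * exp (A n))"
    unfolding A_def by (intro mult_left_mono qf_upper a ja) (use pos in auto)
  also have "\<dots> = \<Theta> * (\<theta>' * (exp (- \<Theta>) * exp (A n)))" by simp
  also have "\<dots> \<le> \<Theta> * (\<theta>' * exp (A m))"
    using e pos by (intro mult_left_mono) auto
  also have "\<dots> \<le> \<Theta> * (real m * qf a m)"
    unfolding A_def by (intro mult_left_mono low m1) (use pos in auto)
  also have "\<dots> \<le> \<Theta> * (real n * (2 * qx a j m))"
    by (intro mult_left_mono mult_mono qx) (use m pos qf_nonneg[OF a] in auto)
  finally have "real n * (\<theta>' * exp (- \<Theta>) * qf a n) \<le> real n * (2 * \<Theta> * qx a j m)"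
    by (simp add: mult_ac)
  then have "\<theta>' * exp (- \<Theta>) * qf a n \<le> 2 * \<Theta> * qx a j m" using n1 by simp
  then show ?thesis using pos by (simp add: m_def field_simps)
qed

text \<open>The numbers \<open>j * s j\<close> sum to \<open>n\<close>, so only boundedly many of
  them can exceed n/3.\<close>

lemma card_large_le:
  assumes "s \<in> vecs n" "n \<ge> 1"
  shows "card {j \<in> {1..n}. n < 3 * (j * s j)} \<le> 3"
proof -
  let ?T = "{j \<in> {1..n}. n < 3 * (j * s j)}"
  have "card ?T * n = (\<Sum>j\<in>?T. n)" by simp
  also have "\<dots> \<le> (\<Sum>j\<in>?T. 3 * (j * s j))" by (rule sum_mono) auto
  also have "\<dots> \<le> (\<Sum>j=1..n. 3 * (j * s j))" by (rule sum_mono2) auto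
  also have "\<dots> = 3 * n" using assms(1) by (simp add: vecs_def flip: sum_distrib_left)
  finally show ?thesis using assms(2) by simp
qed

text \<open>The function is split as D + F + c, where \<open>F\<close> is the centred main part and
  \<open>D\<close> collects the exceptional terms. The first summand of the constant comes from
  Cauchy-Schwarz for \<open>D\<close>, the second from the comparison with the independent model for
  \<open>F\<close>.\<close>

lemma variance_bound:
  fixes X :: "nat \<Rightarrow> nat \<Rightarrow> real"
  assumes a: "\<And>i. a i \<ge> 0" and ja: "\<And>j. j \<ge> 1 \<Longrightarrow> real j * a j \<le> \<Theta>"
    and pos: "\<Theta> > 0" "\<theta>' > 0"
    and low: "\<And>m. m \<ge> 1 \<Longrightarrow> \<theta>' * exp (\<Sum>j=1..m. a j) \<le> real m * qf a m"
    and X0: "\<And>j. j \<in> {1..n} \<Longrightarrow> X j 0 = 0" and n: "n \<ge> 1"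
  obtains c where "(\<Sum>s\<in>vecs n. pwt a n s * ((\<Sum>j=1..n. X j (s j)) - c)\<^sup>2)
    \<le> (2 * (real (nat \<lceil>4 * \<Theta>\<^sup>2 / \<theta>'\<rceil>) + 3) + 2 * (12 * \<Theta>\<^sup>2 * exp \<Theta> / \<theta>'\<^sup>2 + 3))
      * (\<Sum>s\<in>vecs n. pwt a n s * (\<Sum>j=1..n. (X j (s j))\<^sup>2))"
proof -
  define J where "J = nat \<lceil>4 * \<Theta>\<^sup>2 / \<theta>'\<rceil>"
  \<comment> \<open>The two conditions are those under which \<open>qx_lower\<close> applies, once
    \<open>k\<close> is positive.\<close>
  define Y where "Y j k = (if J \<le> j \<and> 3 * (j * k) \<le> n then X j k else 0)" for j k
  define A where "A = (\<Sum>j=1..n. a j)"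
  define M where "M j = (\<Sum>k\<le>n. a j ^ k / fact k * (Y j k)\<^sup>2)" for j
  define RX where "RX = (\<Sum>s\<in>vecs n. pwt a n s * (\<Sum>j=1..n. (X j (s j))\<^sup>2))"
  define RY where "RY = (\<Sum>s\<in>vecs n. pwt a n s * (\<Sum>j=1..n. (Y j (s j))\<^sup>2))"
  define D where "D s = (\<Sum>j=1..n. X j (s j) - Y j (s j))" for s
  define \<kappa> where "\<kappa> = \<theta>' * exp (- \<Theta>) / (2 * \<Theta>)"
  have \<kappa>: "\<kappa> > 0" using pos by (simp add: \<kappa>_def)
  note w = pwt_nonneg[OF a]
  have J: "4 * \<Theta>\<^sup>2 / \<theta>' \<le> real J" unfolding J_def by linarith
  have YX: "(Y j k)\<^sup>2 \<le> (X j k)\<^sup>2" for j k by (simp add: Y_def)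
  have RYX: "RY \<le> RX" unfolding RX_def RY_def by (intro sum_mono mult_left_mono YX w)

  \<comment> \<open>The unconditioned second moments are bounded by the conditioned ones, at the
    cost of the factor \<open>\<kappa>\<close> from \<open>qx_lower\<close>.\<close>
  have MRY: "\<kappa> * qf a n * (\<Sum>j=1..n. M j) \<le> RY"
  proof -
    have "\<kappa> * qf a n * M j \<le> (\<Sum>s\<in>vecs n. pwt a n s * (Y j (s j))\<^sup>2)" if j: "j \<in> {1..n}" for j
    proof -
      have sub: "{k. j * k \<le> n} \<subseteq> {..n}" using j by (auto intro: nat_mult_le_imp_le[of j])
      have "M j = (\<Sum>k\<in>{k. j * k \<le> n}. a j ^ k / fact k * (Y j k)\<^sup>2)"
        unfolding M_def by (rule sum.mono_neutral_right) (use sub in \<open>auto simp: Y_def\<close>)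
      then have "\<kappa> * qf a n * M j = (\<Sum>k\<in>{k. j * k \<le> n}. a j ^ k / fact k * (Y j k)\<^sup>2 * (\<kappa> * qf a n))"
        by (simp only: sum_distrib_left mult.commute[of _ "\<kappa> * qf a n"])
      also have "\<dots> \<le> (\<Sum>k\<in>{k. j * k \<le> n}. a j ^ k / fact k * (Y j k)\<^sup>2 * qx a j (n - j * k))"
      proof (rule sum_mono)
        fix k assume "k \<in> {k. j * k \<le> n}"
        show "a j ^ k / fact k * (Y j k)\<^sup>2 * (\<kappa> * qf a n) \<le> a j ^ k / fact k * (Y j k)\<^sup>2 * qx a j (n - j * k)"
        proof (cases "Y j k = 0")
          case False
          \<comment> \<open>Here \<open>X j 0 = 0\<close> excludes k = 0.\<close>
          then have *: "J \<le> j" "3 * (j * k) \<le> n" "k \<noteq> 0"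
            using X0[OF j] by (auto simp: Y_def split: if_splits intro: ccontr)
          have "\<kappa> * qf a n \<le> qx a j (n - j * k)"
            unfolding \<kappa>_def by (rule qx_lower[OF a ja pos low]) (use * j J in auto)
          then show ?thesis by (intro mult_left_mono) (use a in auto)
        qed simp
      qed
      also have "\<dots> = (\<Sum>s\<in>vecs n. pwt a n s * (Y j (s j))\<^sup>2)"
        by (rule sum_vecs_marginal[OF j, symmetric])
      finally show ?thesis .
    qed
    then have "\<kappa> * qf a n * (\<Sum>j=1..n. M j) \<le> (\<Sum>j=1..n. \<Sum>s\<in>vecs n. pwt a n s * (Y j (s j))\<^sup>2)"
      unfolding sum_distrib_left by (rule sum_mono)
    also have "\<dots> = RY" unfolding RY_def by (subst sum.swap) (simp add: sum_distrib_left)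
    finally show ?thesis .
  qed

  obtain c where "real n * (\<Sum>s\<in>vecs n. pwt a n s * ((\<Sum>j=1..n. Y j (s j)) - c)\<^sup>2)
      \<le> 6 * \<Theta> * exp A * (\<Sum>j=1..n. M j) + 3 * real n * RY"
    unfolding A_def M_def RY_def by (rule vecs_second_moment_le[OF a ja, where n = n and Y = Y])
  moreover define F where "F s = (\<Sum>j=1..n. Y j (s j)) - c" for s
  ultimately have F: "real n * (\<Sum>s\<in>vecs n. pwt a n s * (F s)\<^sup>2)
      \<le> 6 * \<Theta> * exp A * (\<Sum>j=1..n. M j) + 3 * real n * RY" by simp
  have M0: "(\<Sum>j=1..n. M j) \<ge> 0" unfolding M_def by (intro sum_nonneg mult_nonneg_nonneg) (use a in auto)
  have "6 * \<Theta> * exp A * (\<Sum>j=1..n. M j) \<le> real n * (12 * \<Theta>\<^sup>2 * exp \<Theta> / \<theta>'\<^sup>2 * RY)"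
  proof -
    have "\<theta>' * \<kappa> * (exp A * (\<Sum>j=1..n. M j)) = \<kappa> * ((\<theta>' * exp A) * (\<Sum>j=1..n. M j))" by simp
    also have "\<dots> \<le> \<kappa> * ((real n * qf a n) * (\<Sum>j=1..n. M j))"
      unfolding A_def by (intro mult_left_mono mult_right_mono low n M0) (use \<kappa> in auto)
    also have "\<dots> = real n * (\<kappa> * qf a n * (\<Sum>j=1..n. M j))" by simp
    also have "\<dots> \<le> real n * RY" by (intro mult_left_mono MRY) simp
    finally have "6 * \<Theta> / (\<theta>' * \<kappa>) * (\<theta>' * \<kappa> * (exp A * (\<Sum>j=1..n. M j))) \<le> 6 * \<Theta> / (\<theta>' * \<kappa>) * (real n * RY)"
      by (rule mult_left_mono) (use pos \<kappa> in auto)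
    moreover have "6 * \<Theta> / (\<theta>' * \<kappa>) * (\<theta>' * \<kappa> * (exp A * (\<Sum>j=1..n. M j))) = 6 * \<Theta> * exp A * (\<Sum>j=1..n. M j)"
      using pos \<kappa> by simp
    \<comment> \<open>The factor 6\<Theta> comes from the second moment bound, \<theta>' from the
      lower bound for \<open>qf\<close>, and \<open>\<kappa>\<close> from the comparison of
      marginals.\<close>
    moreover have "6 * \<Theta> / (\<theta>' * \<kappa>) = 12 * \<Theta>\<^sup>2 * exp \<Theta> / \<theta>'\<^sup>2"
      unfolding \<kappa>_def using pos by (simp add: exp_minus power2_eq_square field_simps)
    ultimately show ?thesis by (simp only: mult_ac)
  qed
  with F have "real n * (\<Sum>s\<in>vecs n. pwt a n s * (F s)\<^sup>2)
      \<le> real n * ((12 * \<Theta>\<^sup>2 * exp \<Theta> / \<theta>'\<^sup>2 + 3) * RY)" by (simp add: algebra_simps)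
  then have "(\<Sum>s\<in>vecs n. pwt a n s * (F s)\<^sup>2) \<le> (12 * \<Theta>\<^sup>2 * exp \<Theta> / \<theta>'\<^sup>2 + 3) * RY"
    using n by (subst (asm) mult_le_cancel_left_pos) auto
  also have "\<dots> \<le> (12 * \<Theta>\<^sup>2 * exp \<Theta> / \<theta>'\<^sup>2 + 3) * RX"
    by (intro mult_left_mono RYX) (use pos in auto)
  finally have FX: "(\<Sum>s\<in>vecs n. pwt a n s * (F s)\<^sup>2) \<le> (12 * \<Theta>\<^sup>2 * exp \<Theta> / \<theta>'\<^sup>2 + 3) * RX" .

  have D: "(D s)\<^sup>2 \<le> (real J + 3) * (\<Sum>j=1..n. (X j (s j))\<^sup>2)" if s: "s \<in> vecs n" for s
  proof -
    \<comment> \<open>Outside \<open>T\<close> the functions \<open>X\<close> and \<open>Y\<close>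
      agree at \<open>s\<close>. Fewer than \<open>J + 1\<close> indices are small and at most 3
      have a large contribution, so Cauchy-Schwarz costs only \<open>J + 3\<close>.\<close>
    define T where "T = {j \<in> {1..n}. j < J} \<union> {j \<in> {1..n}. n < 3 * (j * s j)}"
    have "card {j \<in> {1..n}. j < J} \<le> card {..<J}" by (rule card_mono) auto
    then have "card T \<le> J + 3"
      unfolding T_def using card_large_le[OF s n] card_Un_le[of "{j \<in> {1..n}. j < J}"] by (smt (verit) add_mono card_lessThan order_trans)
    have "D s = (\<Sum>j\<in>T. X j (s j))"
      unfolding D_def by (rule sum.mono_neutral_cong_right) (auto simp: T_def Y_def)
    then have "(D s)\<^sup>2 \<le> (\<Sum>j\<in>T. (X j (s j))\<^sup>2) * real (card T)"
      using sum_squared_le_sum_of_squares[of "\<lambda>j. X j (s j)" T] by simp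
    also have "\<dots> \<le> (\<Sum>j=1..n. (X j (s j))\<^sup>2) * (real J + 3)"
      using \<open>card T \<le> J + 3\<close> by (intro mult_mono sum_mono2) (auto simp: T_def sum_nonneg)
    finally show ?thesis by (simp add: mult.commute)
  qed
  have "(\<Sum>s\<in>vecs n. pwt a n s * (D s)\<^sup>2) \<le> (\<Sum>s\<in>vecs n. pwt a n s * ((real J + 3) * (\<Sum>j=1..n. (X j (s j))\<^sup>2)))"
    by (intro sum_mono mult_left_mono D w)
  also have "\<dots> = (real J + 3) * RX"
    by (simp add: RX_def sum_distrib_left mult_ac)
  finally have DX: "(\<Sum>s\<in>vecs n. pwt a n s * (D s)\<^sup>2) \<le> (real J + 3) * RX" .

  have "(\<Sum>s\<in>vecs n. pwt a n s * ((\<Sum>j=1..n. X j (s j)) - c)\<^sup>2)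
      \<le> (\<Sum>s\<in>vecs n. pwt a n s * (2 * (D s)\<^sup>2 + 2 * (F s)\<^sup>2))"
  proof (intro sum_mono mult_left_mono w)
    fix s
    have e: "(\<Sum>j=1..n. X j (s j)) - c = D s + F s" by (simp add: D_def F_def sum_subtractf)
    have "(D s + F s)\<^sup>2 + (D s - F s)\<^sup>2 = 2 * (D s)\<^sup>2 + 2 * (F s)\<^sup>2"
      by (simp add: power2_eq_square algebra_simps)
    then show "((\<Sum>j=1..n. X j (s j)) - c)\<^sup>2 \<le> 2 * (D s)\<^sup>2 + 2 * (F s)\<^sup>2"
      unfolding e using zero_le_power2[of "D s - F s"] by linarith
  qed
  also have "\<dots> = 2 * (\<Sum>s\<in>vecs n. pwt a n s * (D s)\<^sup>2) + 2 * (\<Sum>s\<in>vecs n. pwt a n s * (F s)\<^sup>2)"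
    by (simp add: distrib_left sum.distrib sum_distrib_left mult_ac)
  also have "\<dots> \<le> (2 * (real J + 3) + 2 * (12 * \<Theta>\<^sup>2 * exp \<Theta> / \<theta>'\<^sup>2 + 3)) * RX"
    using DX FX by (simp add: distrib_right)
  finally show thesis by (intro that[of c]) (simp add: J_def RX_def)
qed

section \<open>Rescaling and return to assemblies\<close>

lemma pwt_scale:
  assumes "s \<in> vecs n"
  shows "pwt (\<lambda>j. r ^ j * b j) n s = r ^ n * pwt b n s"
proof -
  have "pwt (\<lambda>j. r ^ j * b j) n s = (\<Prod>i=1..n. r ^ (i * s i)) * pwt b n s"
    unfolding pwt_def prod.distrib[symmetric]
    by (intro prod.cong refl) (simp add: power_mult_distrib power_mult)
  \<comment> \<open>The powers of \<open>r\<close> depend on \<open>s\<close> only through its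
    length, so rescaling leaves the conditioned law unchanged when \<open>r\<close> is
    nonzero.\<close>
  also have "(\<Prod>i=1..n. r ^ (i * s i)) = r ^ n"
    using assms by (simp add: power_sum[symmetric] vecs_def)
  finally show ?thesis .
qed

text \<open>Identifies the sum in the theorem as the expectation of the sum of the squares
  \<open>(h j (s j))\<^sup>2\<close>; the terms with k = 0 drop out because
  \<open>h j 0 = 0\<close>.\<close>

lemma sum_marginals:
  assumes h0: "\<And>j. j \<in> {1..n} \<Longrightarrow> h j 0 = (0::real)"
  shows "(\<Sum>(j, k)\<in>{(j, k). 1 \<le> j \<and> 1 \<le> k \<and> j * k \<le> n}.
            lam g j ^ k * (h j k)\<^sup>2 / fact k * (Qexcl g j (n - j * k) / Qf g n))
       = (\<Sum>s\<in>vecs n. weight g n s * (\<Sum>j=1..n. (h j (s j))\<^sup>2)) / Qf g n"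
proof -
  define t where "t = (\<lambda>j k. lam g j ^ k / fact k * (h j k)\<^sup>2 * Qexcl g j (n - j * k))"
  have fin: "finite {k. j * k \<le> n}" if "j \<ge> 1" for j
    by (rule finite_subset[of _ "{..n}"]) (use that in \<open>auto intro: nat_mult_le_imp_le[of j]\<close>)
  have eq: "{(j, k). 1 \<le> j \<and> 1 \<le> k \<and> j * k \<le> n} = Sigma {1..n} (\<lambda>j. {k. 1 \<le> k \<and> j * k \<le> n})"
  proof -
    have le: "j \<le> n" if "1 \<le> k" "j * k \<le> n" for j k
      using that nat_mult_le_imp_le[of k j n] by (simp add: mult.commute)
    show ?thesis by (auto simp del: One_nat_def intro: le)
  qed
  have fin': "finite {k. 1 \<le> k \<and> j * k \<le> n}" if "j \<ge> 1" for j
    by (rule finite_subset[OF _ fin[OF that]]) auto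
  have "(\<Sum>(j, k)\<in>{(j, k). 1 \<le> j \<and> 1 \<le> k \<and> j * k \<le> n}.
            lam g j ^ k * (h j k)\<^sup>2 / fact k * (Qexcl g j (n - j * k) / Qf g n))
      = (\<Sum>(j, k)\<in>Sigma {1..n} (\<lambda>j. {k. 1 \<le> k \<and> j * k \<le> n}). t j k / Qf g n)"
    unfolding eq t_def by (intro sum.cong refl) auto
  also have "\<dots> = (\<Sum>j=1..n. \<Sum>k\<in>{k. 1 \<le> k \<and> j * k \<le> n}. t j k / Qf g n)"
    by (rule sum.Sigma[symmetric]) (use fin' in auto)
  also have "\<dots> = (\<Sum>j=1..n. (\<Sum>s\<in>vecs n. weight g n s * (h j (s j))\<^sup>2) / Qf g n)"
  proof (rule sum.cong[OF refl])
    fix j assume j: "j \<in> {1..n}"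
    have "(\<Sum>s\<in>vecs n. weight g n s * (h j (s j))\<^sup>2) = (\<Sum>k\<in>{k. j * k \<le> n}. t j k)"
      unfolding weight_eq_pwt t_def Qexcl_def
      using sum_vecs_marginal[OF j, of "lam g" "\<lambda>k. (h j k)\<^sup>2"] by (simp add: qx_def)
    also have "\<dots> = (\<Sum>k\<in>{k. 1 \<le> k \<and> j * k \<le> n}. t j k)"
      by (rule sum.mono_neutral_right) (use fin[of j] j h0[OF j] in \<open>auto simp: t_def not_le\<close>)
    finally show "(\<Sum>k\<in>{k. 1 \<le> k \<and> j * k \<le> n}. t j k / Qf g n)
        = (\<Sum>s\<in>vecs n. weight g n s * (h j (s j))\<^sup>2) / Qf g n"
      by (simp add: sum_divide_distrib)
  qed
  also have "\<dots> = (\<Sum>s\<in>vecs n. weight g n s * (\<Sum>j=1..n. (h j (s j))\<^sup>2)) / Qf g n"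
    unfolding sum_divide_distrib[symmetric] by (subst sum.swap) (simp add: sum_distrib_left)
  finally show ?thesis .
qed

text \<open>The mean minimizes the sum of squared deviations, so the variance may be estimated with
  any convenient centre \<open>c\<close>.\<close>

lemma sum_square_deviation_le:
  fixes F :: "'a \<Rightarrow> real"
  assumes "finite S"
  shows "(\<Sum>x\<in>S. (F x - (\<Sum>x\<in>S. F x) / real (card S))\<^sup>2) \<le> (\<Sum>x\<in>S. (F x - c)\<^sup>2)"
proof (cases "S = {}")
  case False
  define m where "m = (\<Sum>x\<in>S. F x) / real (card S)"
  have m: "(\<Sum>x\<in>S. F x - m) = 0"
    using assms False by (simp add: m_def sum_subtractf)
  have "(\<Sum>x\<in>S. (F x - c)\<^sup>2) = (\<Sum>x\<in>S. (F x - m)\<^sup>2 + 2 * (m - c) * (F x - m) + (m - c)\<^sup>2)"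
    by (intro sum.cong refl) (simp add: power2_eq_square algebra_simps)
  also have "\<dots> = (\<Sum>x\<in>S. (F x - m)\<^sup>2) + real (card S) * (m - c)\<^sup>2"
    by (simp add: sum.distrib m flip: sum_distrib_left)
  finally show ?thesis by (simp add: m_def)
qed simp

lemma finite_assemblies: "Qf g n > 0 \<Longrightarrow> finite (assemblies g n)"
  using card_assemblies[of g n] by (intro card_ge_0_finite) (simp flip: of_nat_0_less_iff[where 'a = real])

lemma Vn_le:
  assumes "Qf g n > 0"
  shows "Vn g n (additive n h) \<le> (\<Sum>s\<in>vecs n. weight g n s * ((\<Sum>j=1..n. h j (s j)) - c)\<^sup>2) / Qf g n"
proof -
  have "Vn g n (additive n h) \<le> En g n (\<lambda>\<sigma>. (additive n h \<sigma> - c)\<^sup>2)"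
    unfolding Vn_def En_def
    by (intro divide_right_mono sum_square_deviation_le finite_assemblies assms) simp
  also have "\<dots> = (\<Sum>s\<in>vecs n. weight g n s * ((\<Sum>j=1..n. h j (s j)) - c)\<^sup>2) / Qf g n"
    unfolding additive_def by (rule En_eq)
  finally show ?thesis .
qed

theorem theorem1:
  fixes \<rho> \<Theta> \<theta> \<theta>' :: real and n0 :: nat
  assumes "\<rho> > 0" "\<Theta> > 0" "\<theta> > 0" "\<theta>' > 0" "n0 \<ge> 1"
  shows "\<exists>C>0. \<forall>g n (h :: nat \<Rightarrow> nat \<Rightarrow> real).
           weakly_log g \<rho> \<Theta> \<theta> \<theta>' n0 \<and> n \<ge> 1 \<and> (\<forall>j\<in>{1..n}. h j 0 = 0) \<longrightarrow>
           Vn g n (additive n h) \<le>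
             C * (\<Sum>(j, k)\<in>{(j, k). 1 \<le> j \<and> 1 \<le> k \<and> j * k \<le> n}.
                    lam g j ^ k * (h j k)^2 / fact k * (Qexcl g j (n - j * k) / Qf g n))"
proof (intro exI conjI allI impI)
  \<comment> \<open>Fixed before \<open>g\<close>, \<open>n\<close> and \<open>h\<close> are
    introduced, hence uniform in all three.\<close>
  define C where "C = 2 * (real (nat \<lceil>4 * \<Theta>\<^sup>2 / \<theta>'\<rceil>) + 3) + 2 * (12 * \<Theta>\<^sup>2 * exp \<Theta> / \<theta>'\<^sup>2 + 3)"
  show "C > 0" unfolding C_def by (intro add_pos_pos mult_pos_pos add_nonneg_pos) auto
  fix g n and h :: "nat \<Rightarrow> nat \<Rightarrow> real"
  assume "weakly_log g \<rho> \<Theta> \<theta> \<theta>' n0 \<and> n \<ge> 1 \<and> (\<forall>j\<in>{1..n}. h j 0 = 0)"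
  then have wl: "weakly_log g \<rho> \<Theta> \<theta> \<theta>' n0" and n: "n \<ge> 1" and h0: "\<And>j. j \<in> {1..n} \<Longrightarrow> h j 0 = 0"
    by auto
  \<comment> \<open>With these parameters, conditions (i) and (iii) of a weakly logarithmic class
    become the bounds \<open>ja\<close> and \<open>low\<close>.\<close>
  define a where "a j = \<rho> ^ j * lam g j" for j
  have pwt_a: "pwt a m s = \<rho> ^ m * weight g m s" if "s \<in> vecs m" for m s
    unfolding a_def weight_eq_pwt using that by (rule pwt_scale)
  have qf_a: "qf a m = \<rho> ^ m * Qf g m" for m
    unfolding qf_def Qf_def sum_distrib_left by (intro sum.cong refl pwt_a)
  have a: "a i \<ge> 0" for i using assms(1) by (simp add: a_def lam_def)
  have ja: "real j * a j \<le> \<Theta>" if "j \<ge> 1" for j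
    using wl that by (auto simp: weakly_log_def a_def mult_ac)
  have low: "\<theta>' * exp (\<Sum>j=1..m. a j) \<le> real m * qf a m" if "m \<ge> 1" for m
    using wl that by (auto simp: weakly_log_def a_def qf_a mult_ac)
  \<comment> \<open>Positivity of \<open>Qf g n\<close> makes the set of assemblies finite and
    nonempty and justifies the divisions below.\<close>
  have "0 < \<theta>' * exp (\<Sum>j=1..n. a j)" using assms(4) by simp
  then have "0 < real n * qf a n" using low[OF n] by linarith
  then have Q: "Qf g n > 0" using assms(1) n by (simp add: qf_a zero_less_mult_iff)
  obtain c where c: "(\<Sum>s\<in>vecs n. pwt a n s * ((\<Sum>j=1..n. h j (s j)) - c)\<^sup>2)
      \<le> C * (\<Sum>s\<in>vecs n. pwt a n s * (\<Sum>j=1..n. (h j (s j))\<^sup>2))"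
    unfolding C_def by (rule variance_bound[where a = a and n = n and X = h, OF a ja assms(2,4) low h0 n])
  have scale: "(\<Sum>s\<in>vecs n. pwt a n s * f s) = \<rho> ^ n * (\<Sum>s\<in>vecs n. weight g n s * f s)" for f
    by (simp add: pwt_a sum_distrib_left mult.assoc)
  have "\<rho> ^ n * (\<Sum>s\<in>vecs n. weight g n s * ((\<Sum>j=1..n. h j (s j)) - c)\<^sup>2)
      \<le> \<rho> ^ n * (C * (\<Sum>s\<in>vecs n. weight g n s * (\<Sum>j=1..n. (h j (s j))\<^sup>2)))"
    using c unfolding scale by (simp only: mult.left_commute)
  then have *: "(\<Sum>s\<in>vecs n. weight g n s * ((\<Sum>j=1..n. h j (s j)) - c)\<^sup>2)
      \<le> C * (\<Sum>s\<in>vecs n. weight g n s * (\<Sum>j=1..n. (h j (s j))\<^sup>2))"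
    using assms(1) by simp
  have "Vn g n (additive n h) \<le> (\<Sum>s\<in>vecs n. weight g n s * ((\<Sum>j=1..n. h j (s j)) - c)\<^sup>2) / Qf g n"
    by (rule Vn_le[OF Q])
  also have "\<dots> \<le> C * (\<Sum>s\<in>vecs n. weight g n s * (\<Sum>j=1..n. (h j (s j))\<^sup>2)) / Qf g n"
    using * Q by (intro divide_right_mono) auto
  finally show "Vn g n (additive n h) \<le>
      C * (\<Sum>(j, k)\<in>{(j, k). 1 \<le> j \<and> 1 \<le> k \<and> j * k \<le> n}.
             lam g j ^ k * (h j k)^2 / fact k * (Qexcl g j (n - j * k) / Qf g n))"
    by (subst sum_marginals[where h = h, OF h0]) simp_all
qed

end
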